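(* Let $\mathcal{C}$ be a Conway category and let $\mathbf{Q}$ be a finite automaton. If $\mathcal{C}$ satisfies the identity $\Gamma(\mathbf{Q})$ associated with $\mathbf{Q}$, then $\mathcal{C}$ satisfies the group identity $\Gamma(G)$ for every finite simple group $G$ that divides the monoid $M(\mathbf{Q})$.
   Context: Cartesian categories have chosen finite products (terminal object $T$, projections $\pi_i$, tupling $\langle\cdot\rangle$, $!_A:A\to T$, $f\times g$), strictly associative; composition is written $g\circ f$; $\Delta_{A^n}=\langle 1_A,\ldots,1_A\rangle:A\to A^n$. A dagger operation maps $f:A\times C\to A$ to $f^\dagger:C\to A$. A Conway category is a cartesian category with dagger satisfying: $(f\circ(1_A\times g))^\dagger=f^\dagger\circ g$ ($f:A\times B\to A$, $g:C\to B$); $f^{\dagger\dagger}=(f\circ(\Delta_{A^2}\times 1_C))^\dagger$ ($f:A\times A\times C\to A$); $(f\circ\langle g,\pi_2^{A\times C}\rangle)^\dagger=f\circ\langle (g\circ\langle f,\pi_2^{B\times C}\rangle)^\dagger,1_C\rangle$ ($f:B\times C\to A$, $g:A\times C\to B$). A finite automaton $\mathbf{Q}=(Q,Z,\cdot)$ has finite nonempty state set $Q$, finite nonempty input alphabet $Z$ and action $Q\times Z\to Q$, extended to words; $M(\mathbf{Q})$ is the monoid of functions $Q\to Q$, $q\mapsto qu$, induced by words $u\in Z^*$. Write $Q=\{q_1,\ldots,q_n\}$, identified with $\{1,\ldots,n\}$, and $Z=\{a_1,\ldots,a_m\}$. For an object $A$ and $i\in[n]$ let $\rho_i^{\mathbf{Q},A}=\langle\pi^{A^n}_{ia_1},\ldots,\pi^{A^n}_{ia_m}\rangle:A^n\to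 A^m$ (here $ia_j$ is the index of the state $q_i\cdot a_j$). For $f:A^m\times C\to A$ let $f^{\mathbf{Q},A}:A^n\times C\to A^n$ be the morphism with $\pi_i^{A^n}\circ f^{\mathbf{Q},A}=f\circ(\rho_i^{\mathbf{Q},A}\times 1_C)$ for all $i$. The identity $\Gamma(\mathbf{Q})$ holds in $\mathcal{C}$ if $(f^{\mathbf{Q},A})^\dagger=\Delta_{A^n}\circ(f\circ(\Delta_{A^m}\times 1_C))^\dagger$ for all objects $A,C$ and all $f:A^m\times C\to A$. For a finite group (or monoid) $G$, $\Gamma(G)$ is the identity $\Gamma$ of the automaton $(G,G,\cdot)$ whose action is multiplication. A group in a finite monoid $M$ is a subsemigroup of $M$ which is a group (its unit may be any idempotent); a finite group $G$ divides $M$ if it is a homomorphic image of a group in $M$. A finite group is simple if it is nontrivial and has no normal subgroups other than itself and the trivial one. *)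

theory Defs
  imports "HOL-Algebra.Algebra"
begin

record ('o, 'm) cartcat =
  cc_arr  :: "'m set"
  cc_dom  :: "'m \<Rightarrow> 'o"
  cc_cod  :: "'m \<Rightarrow> 'o"
  cc_cmp  :: "'m \<Rightarrow> 'm \<Rightarrow> 'm"    (* cc_cmp K g f = g o f *)
  cc_id   :: "'o \<Rightarrow> 'm"
  cc_term :: "'o"
  cc_bang :: "'o \<Rightarrow> 'm"
  cc_prod :: "'o \<Rightarrow> 'o \<Rightarrow> 'o"
  cc_pi1  :: "'o \<Rightarrow> 'o \<Rightarrow> 'm"
  cc_pi2  :: "'o \<Rightarrow> 'o \<Rightarrow> 'm"
  cc_tup  :: "'m \<Rightarrow> 'm \<Rightarrow> 'm"
  cc_dag  :: "'o \<Rightarrow> 'm \<Rightarrow> 'm"      (* cc_dag K C f = f^dagger for f : A x C -> A *)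

definition cc_hom :: "('o, 'm) cartcat \<Rightarrow> 'o \<Rightarrow> 'o \<Rightarrow> 'm set" where
  "cc_hom K A B = {f \<in> cc_arr K. cc_dom K f = A \<and> cc_cod K f = B}"

definition is_category :: "('o, 'm) cartcat \<Rightarrow> bool" where
  "is_category K \<longleftrightarrow>
     (\<forall>A. cc_id K A \<in> cc_hom K A A) \<and>
     (\<forall>A B C f g. f \<in> cc_hom K A B \<longrightarrow> g \<in> cc_hom K B C \<longrightarrow> cc_cmp K g f \<in> cc_hom K A C) \<and>
     (\<forall>A B C D f g h. f \<in> cc_hom K A B \<longrightarrow> g \<in> cc_hom K B C \<longrightarrow> h \<in> cc_hom K C D \<longrightarrow>
        cc_cmp K h (cc_cmp K g f) = cc_cmp K (cc_cmp K h g) f) \<and>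
     (\<forall>A B f. f \<in> cc_hom K A B \<longrightarrow> cc_cmp K f (cc_id K A) = f \<and> cc_cmp K (cc_id K B) f = f)"

text \<open>Cartesian category: chosen finite products (terminal object, binary products),
  strictly associative: (A x B) x C = A x (B x C) and the canonical associativity
  morphism is the identity.\<close>

definition is_cartesian :: "('o, 'm) cartcat \<Rightarrow> bool" where
  "is_cartesian K \<longleftrightarrow> is_category K \<and>
     (\<forall>A. cc_bang K A \<in> cc_hom K A (cc_term K)) \<and>
     (\<forall>A f. f \<in> cc_hom K A (cc_term K) \<longrightarrow> f = cc_bang K A) \<and>
     (\<forall>A B. cc_pi1 K A B \<in> cc_hom K (cc_prod K A B) A \<and> cc_pi2 K A B \<in> cc_hom K (cc_prod K A B) B) \<and>
     (\<forall>A B C f g. f \<in> cc_hom K C A \<longrightarrow> g \<in> cc_hom K C B \<longrightarrow>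
        cc_tup K f g \<in> cc_hom K C (cc_prod K A B) \<and>
        cc_cmp K (cc_pi1 K A B) (cc_tup K f g) = f \<and>
        cc_cmp K (cc_pi2 K A B) (cc_tup K f g) = g) \<and>
     (\<forall>A B C h. h \<in> cc_hom K C (cc_prod K A B) \<longrightarrow>
        h = cc_tup K (cc_cmp K (cc_pi1 K A B) h) (cc_cmp K (cc_pi2 K A B) h)) \<and>
     (\<forall>A B C. cc_prod K (cc_prod K A B) C = cc_prod K A (cc_prod K B C)) \<and>
     (\<forall>A B C. cc_tup K (cc_cmp K (cc_pi1 K A B) (cc_pi1 K (cc_prod K A B) C))
                (cc_tup K (cc_cmp K (cc_pi2 K A B) (cc_pi1 K (cc_prod K A B) C))
                          (cc_pi2 K (cc_prod K A B) C))
              = cc_id K (cc_prod K A (cc_prod K B C)))"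

definition cc_cross :: "('o, 'm) cartcat \<Rightarrow> 'm \<Rightarrow> 'm \<Rightarrow> 'm" where
  "cc_cross K f g =
     cc_tup K (cc_cmp K f (cc_pi1 K (cc_dom K f) (cc_dom K g)))
              (cc_cmp K g (cc_pi2 K (cc_dom K f) (cc_dom K g)))"

fun cc_pow :: "('o, 'm) cartcat \<Rightarrow> 'o \<Rightarrow> nat \<Rightarrow> 'o" where
  "cc_pow K A 0 = cc_term K"
| "cc_pow K A (Suc 0) = A"
| "cc_pow K A (Suc (Suc n)) = cc_prod K A (cc_pow K A (Suc n))"

fun cc_proj :: "('o, 'm) cartcat \<Rightarrow> 'o \<Rightarrow> nat \<Rightarrow> nat \<Rightarrow> 'm" where
  "cc_proj K A 0 i = undefined"
| "cc_proj K A (Suc 0) i = cc_id K A"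
| "cc_proj K A (Suc (Suc n)) 0 = cc_pi1 K A (cc_pow K A (Suc n))"
| "cc_proj K A (Suc (Suc n)) (Suc i) =
     cc_cmp K (cc_proj K A (Suc n) i) (cc_pi2 K A (cc_pow K A (Suc n)))"

fun cc_tupN :: "('o, 'm) cartcat \<Rightarrow> nat \<Rightarrow> (nat \<Rightarrow> 'm) \<Rightarrow> 'm" where
  "cc_tupN K 0 fs = undefined"
| "cc_tupN K (Suc 0) fs = fs 0"
| "cc_tupN K (Suc (Suc n)) fs = cc_tup K (fs 0) (cc_tupN K (Suc n) (\<lambda>i. fs (Suc i)))"

definition cc_diag :: "('o, 'm) cartcat \<Rightarrow> 'o \<Rightarrow> nat \<Rightarrow> 'm" where
  "cc_diag K A n = cc_tupN K n (\<lambda>_. cc_id K A)"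

definition is_conway :: "('o, 'm) cartcat \<Rightarrow> bool" where
  "is_conway K \<longleftrightarrow> is_cartesian K \<and>
     (\<forall>A C f. f \<in> cc_hom K (cc_prod K A C) A \<longrightarrow> cc_dag K C f \<in> cc_hom K C A) \<and>
     (\<forall>A B C f g. f \<in> cc_hom K (cc_prod K A B) A \<longrightarrow> g \<in> cc_hom K C B \<longrightarrow>
        cc_dag K C (cc_cmp K f (cc_cross K (cc_id K A) g)) = cc_cmp K (cc_dag K B f) g) \<and>
     (\<forall>A C f. f \<in> cc_hom K (cc_prod K A (cc_prod K A C)) A \<longrightarrow>
        cc_dag K C (cc_dag K (cc_prod K A C) f) =
        cc_dag K C (cc_cmp K f (cc_cross K (cc_diag K A 2) (cc_id K C)))) \<and>
     (\<forall>A B C f g. f \<in> cc_hom K (cc_prod K B C) A \<longrightarrow> g \<in> cc_hom K (cc_prod K A C) B \<longrightarrow>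
        cc_dag K C (cc_cmp K f (cc_tup K g (cc_pi2 K A C))) =
        cc_cmp K f (cc_tup K (cc_dag K C (cc_cmp K g (cc_tup K f (cc_pi2 K B C)))) (cc_id K C)))"

section \<open>Finite automata with states {0..<n}, letters {0..<m}, action delta\<close>

definition fin_automaton :: "nat \<Rightarrow> nat \<Rightarrow> (nat \<Rightarrow> nat \<Rightarrow> nat) \<Rightarrow> bool" where
  "fin_automaton n m \<delta> \<longleftrightarrow> n \<ge> 1 \<and> m \<ge> 1 \<and> (\<forall>i<n. \<forall>j<m. \<delta> i j < n)"

definition cc_rho :: "('o, 'm) cartcat \<Rightarrow> 'o \<Rightarrow> nat \<Rightarrow> nat \<Rightarrow> (nat \<Rightarrow> nat \<Rightarrow> nat) \<Rightarrow> nat \<Rightarrow> 'm" where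
  "cc_rho K A n m \<delta> i = cc_tupN K m (\<lambda>j. cc_proj K A n (\<delta> i j))"

definition cc_fQ :: "('o, 'm) cartcat \<Rightarrow> 'o \<Rightarrow> 'o \<Rightarrow> nat \<Rightarrow> nat \<Rightarrow> (nat \<Rightarrow> nat \<Rightarrow> nat) \<Rightarrow> 'm \<Rightarrow> 'm" where
  "cc_fQ K A C n m \<delta> f =
     cc_tupN K n (\<lambda>i. cc_cmp K f (cc_cross K (cc_rho K A n m \<delta> i) (cc_id K C)))"

definition satisfies_Gamma :: "('o, 'm) cartcat \<Rightarrow> nat \<Rightarrow> nat \<Rightarrow> (nat \<Rightarrow> nat \<Rightarrow> nat) \<Rightarrow> bool" where
  "satisfies_Gamma K n m \<delta> \<longleftrightarrow>
     (\<forall>A C f. f \<in> cc_hom K (cc_prod K (cc_pow K A m) C) A \<longrightarrow>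
        cc_dag K C (cc_fQ K A C n m \<delta> f) =
        cc_cmp K (cc_diag K A n) (cc_dag K C (cc_cmp K f (cc_cross K (cc_diag K A m) (cc_id K C)))))"

text \<open>Transition monoid M(Q): functions q |-> q u on {0..<n}, u a word;
  product f g = (q |-> g (f q)), i.e. the function of the word uv.\<close>

definition trans_monoid :: "nat \<Rightarrow> nat \<Rightarrow> (nat \<Rightarrow> nat \<Rightarrow> nat) \<Rightarrow> (nat \<Rightarrow> nat) monoid" where
  "trans_monoid n m \<delta> =
     \<lparr>carrier = {restrict (\<lambda>q. foldl \<delta> q w) {0..<n} | w. set w \<subseteq> {0..<m}},
      monoid.mult = (\<lambda>f g. restrict (g \<circ> f) {0..<n}),
      one = restrict id {0..<n}\<rparr>"

definition group_divides :: "('g, 'x) monoid_scheme \<Rightarrow> ('a, 'y) monoid_scheme \<Rightarrow> bool" where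
  "group_divides G M \<longleftrightarrow>
     (\<exists>H e h. H \<subseteq> carrier M \<and>
        group (\<lparr>carrier = H, monoid.mult = monoid.mult M, one = e\<rparr> :: 'a monoid) \<and>
        h \<in> hom (\<lparr>carrier = H, monoid.mult = monoid.mult M, one = e\<rparr> :: 'a monoid) G \<and>
        h ` H = carrier G)"

text \<open>The automaton (G, G, .) of a finite group, with states and letters enumerated by
  a bijection e : {0..<|G|} -> G.\<close>

definition group_automaton :: "('g, 'x) monoid_scheme \<Rightarrow> (nat \<Rightarrow> 'g) \<Rightarrow> nat \<Rightarrow> nat \<Rightarrow> nat" where
  "group_automaton G e i j = the_inv_into {0..<card (carrier G)} e (e i \<otimes>\<^bsub>G\<^esub> e j)"

end

theory Submission
  imports Defs
begin

text \<open>
  The identity \<open>\<Gamma>(Q)\<close> is inherited along every operation needed to pass from \<open>Q\<close> to \<open>G\<close>.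
  Subautomata and the choice of the power object are handled by the double dagger identity.
  If \<open>\<Gamma>(I)\<close> holds, applying it at the object \<open>A\<^sup>J\<close> shows that component \<open>(i, j)\<close> of the solution of
  the system of \<open>I \<times> J\<close> equals component \<open>j\<close> of the solution of the system of \<open>J\<close>; hence \<open>\<Gamma>\<close> is
  inherited by products, and also by quotients \<open>\<psi> : I \<rightarrow> J\<close>, since \<open>i \<mapsto> (i, \<psi> i)\<close> embeds
  \<open>I\<close> into \<open>I \<times> J\<close>. Letters may be replaced by nonempty words: apply \<open>\<Gamma>(I)\<close> at \<open>A\<^sup>U\<close>, where \<open>U\<close>
  is a finite set of words and the coordinate \<open>u\<close> of state \<open>i\<close> stands for the unknown of the state
  \<open>i u\<close>, and eliminate the auxiliary unknowns. Now let \<open>H\<close> be a group in \<open>M(Q)\<close> with image \<open>G\<close>. Replacing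
  the letters of \<open>Q\<close> by words that represent elements of \<open>H\<close> lying over the elements of \<open>G\<close>, the set \<open>H\<close>
  becomes a subautomaton of a power of \<open>Q\<close> and \<open>(G, G, \<cdot>)\<close> a quotient of it.
\<close>

section \<open>Conway categories\<close>

locale conway =
  fixes K :: "('o, 'm) cartcat"
  assumes conway: "is_conway K"
begin

abbreviation "Hom \<equiv> cc_hom K"
abbreviation "arr f \<equiv> f \<in> cc_arr K"
abbreviation dom :: "'m \<Rightarrow> 'o" where "dom \<equiv> cc_dom K"
abbreviation cod :: "'m \<Rightarrow> 'o" where "cod \<equiv> cc_cod K"
abbreviation comp (infixr "\<bullet>" 75) where "g \<bullet> f \<equiv> cc_cmp K g f"
abbreviation pair ("\<langle>_,/ _\<rangle>") where "\<langle>f, g\<rangle> \<equiv> cc_tup K f g"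
abbreviation prod_obj (infixr "\<^bold>\<times>" 80) where "A \<^bold>\<times> B \<equiv> cc_prod K A B"
abbreviation "\<pi>\<^sub>1 \<equiv> cc_pi1 K"
abbreviation "\<pi>\<^sub>2 \<equiv> cc_pi2 K"
abbreviation "ident \<equiv> cc_id K"
abbreviation "dag \<equiv> cc_dag K"

section \<open>Categories and strictly associative products\<close>

lemma Hom_iff [simp]: "f \<in> Hom A B \<longleftrightarrow> arr f \<and> dom f = A \<and> cod f = B"
  by (auto simp: cc_hom_def)

lemma cartesian: "is_cartesian K" and category: "is_category K"
  using conway by (auto simp: is_conway_def is_cartesian_def)

lemma ident_simps [simp]: "arr (ident A)" "dom (ident A) = A" "cod (ident A) = A"
  using category unfolding is_category_def by auto

lemma comp_simps [simp]:
  assumes "arr f" "arr g" "cod f = dom g"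
  shows "arr (g \<bullet> f)" "dom (g \<bullet> f) = dom f" "cod (g \<bullet> f) = cod g"
proof -
  have "g \<bullet> f \<in> Hom (dom f) (cod g)"
    using category assms unfolding is_category_def Hom_iff by metis
  then show "arr (g \<bullet> f)" "dom (g \<bullet> f) = dom f" "cod (g \<bullet> f) = cod g" by auto
qed

lemma comp_assoc [simp]:
  assumes "arr f" "arr g" "arr h" "cod f = dom g" "cod g = dom h"
  shows "(h \<bullet> g) \<bullet> f = h \<bullet> g \<bullet> f"
  using category assms unfolding is_category_def Hom_iff by metis

lemma comp_ident [simp]:
  assumes "arr f"
  shows "dom f = A \<Longrightarrow> f \<bullet> ident A = f" "cod f = A \<Longrightarrow> ident A \<bullet> f = f"
  using category assms unfolding is_category_def Hom_iff by metis+

lemma proj_simps [simp]: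
  "arr (\<pi>\<^sub>1 A B)" "dom (\<pi>\<^sub>1 A B) = A \<^bold>\<times> B" "cod (\<pi>\<^sub>1 A B) = A"
  "arr (\<pi>\<^sub>2 A B)" "dom (\<pi>\<^sub>2 A B) = A \<^bold>\<times> B" "cod (\<pi>\<^sub>2 A B) = B"
  using cartesian unfolding is_cartesian_def by auto

lemma pair_facts:
  assumes "arr f" "arr g" "dom f = dom g"
  shows "\<langle>f, g\<rangle> \<in> Hom (dom f) (cod f \<^bold>\<times> cod g) \<and> \<pi>\<^sub>1 (cod f) (cod g) \<bullet> \<langle>f, g\<rangle> = f \<and>
    \<pi>\<^sub>2 (cod f) (cod g) \<bullet> \<langle>f, g\<rangle> = g"
proof -
  have "\<forall>A B C f g. f \<in> Hom C A \<longrightarrow> g \<in> Hom C B \<longrightarrow>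
        \<langle>f, g\<rangle> \<in> Hom C (A \<^bold>\<times> B) \<and> \<pi>\<^sub>1 A B \<bullet> \<langle>f, g\<rangle> = f \<and> \<pi>\<^sub>2 A B \<bullet> \<langle>f, g\<rangle> = g"
    using cartesian unfolding is_cartesian_def by (elim conjE) assumption
  from this[rule_format, of f "dom f" "cod f" g "cod g"] show ?thesis using assms by auto
qed

lemma pair_simps [simp]:
  assumes "arr f" "arr g" "dom f = dom g"
  shows "arr \<langle>f, g\<rangle>" "dom \<langle>f, g\<rangle> = dom g" "cod \<langle>f, g\<rangle> = cod f \<^bold>\<times> cod g"
  using pair_facts[OF assms] assms by auto

lemma proj_pair [simp]:
  assumes "arr f" "arr g" "dom f = dom g" "cod f = A" "cod g = B"
  shows "\<pi>\<^sub>1 A B \<bullet> \<langle>f, g\<rangle> = f" "\<pi>\<^sub>2 A B \<bullet> \<langle>f, g\<rangle> = g"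
  using pair_facts[OF assms(1-3)] assms by auto

lemma pair_eta:
  assumes "arr h" "cod h = A \<^bold>\<times> B"
  shows "\<langle>\<pi>\<^sub>1 A B \<bullet> h, \<pi>\<^sub>2 A B \<bullet> h\<rangle> = h"
proof -
  have "\<forall>A B C h. h \<in> Hom C (A \<^bold>\<times> B) \<longrightarrow> h = \<langle>\<pi>\<^sub>1 A B \<bullet> h, \<pi>\<^sub>2 A B \<bullet> h\<rangle>"
    using cartesian unfolding is_cartesian_def by (elim conjE) assumption
  from this[rule_format, of h "dom h" A B] show ?thesis using assms by auto
qed

lemma pair_eqI:
  assumes "u \<in> Hom Y (A \<^bold>\<times> B)" "v \<in> Hom Y (A \<^bold>\<times> B)"
    and "\<pi>\<^sub>1 A B \<bullet> u = \<pi>\<^sub>1 A B \<bullet> v" "\<pi>\<^sub>2 A B \<bullet> u = \<pi>\<^sub>2 A B \<bullet> v"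
  shows "u = v"
  using assms pair_eta unfolding Hom_iff by metis

lemma pair_proj [simp]: "\<langle>\<pi>\<^sub>1 A B, \<pi>\<^sub>2 A B\<rangle> = ident (A \<^bold>\<times> B)"
  using pair_eta[of "ident (A \<^bold>\<times> B)" A B] by simp

lemma pair_comp [simp]:
  assumes "arr f" "arr g" "arr h" "dom f = dom g" "cod h = dom g"
  shows "\<langle>f, g\<rangle> \<bullet> h = \<langle>f \<bullet> h, g \<bullet> h\<rangle>"
proof -
  have "\<pi>\<^sub>1 (cod f) (cod g) \<bullet> \<langle>f, g\<rangle> \<bullet> h = f \<bullet> h" "\<pi>\<^sub>2 (cod f) (cod g) \<bullet> \<langle>f, g\<rangle> \<bullet> h = g \<bullet> h"
    using comp_assoc[of h "\<langle>f, g\<rangle>" "\<pi>\<^sub>1 (cod f) (cod g)"]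
      comp_assoc[of h "\<langle>f, g\<rangle>" "\<pi>\<^sub>2 (cod f) (cod g)"] assms by auto
  then show ?thesis
    using pair_eta[of "\<langle>f, g\<rangle> \<bullet> h" "cod f" "cod g"] assms by simp
qed

lemma pair_assoc:
  assumes "arr f" "arr g" "arr h" "dom f = dom g" "dom g = dom h"
  shows "\<langle>\<langle>f, g\<rangle>, h\<rangle> = \<langle>f, \<langle>g, h\<rangle>\<rangle>"
proof -
  have "\<forall>A B C. \<langle>\<pi>\<^sub>1 A B \<bullet> \<pi>\<^sub>1 (A \<^bold>\<times> B) C, \<langle>\<pi>\<^sub>2 A B \<bullet> \<pi>\<^sub>1 (A \<^bold>\<times> B) C, \<pi>\<^sub>2 (A \<^bold>\<times> B) C\<rangle>\<rangle> =
      ident (A \<^bold>\<times> (B \<^bold>\<times> C))"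
    using cartesian unfolding is_cartesian_def by (elim conjE) assumption
  moreover have "\<forall>A B C. (A \<^bold>\<times> B) \<^bold>\<times> C = A \<^bold>\<times> (B \<^bold>\<times> C)"
    using cartesian unfolding is_cartesian_def by (elim conjE) assumption
  \<comment> \<open>The canonical associativity morphism is composed with
    \<open>\<langle>\<langle>f, g\<rangle>, h\<rangle>\<close>: evaluation gives the right-nested
    tuple, the identity gives back the left-nested one.\<close>
  ultimately have "\<langle>\<pi>\<^sub>1 (cod f) (cod g) \<bullet> \<pi>\<^sub>1 (cod f \<^bold>\<times> cod g) (cod h),
      \<langle>\<pi>\<^sub>2 (cod f) (cod g) \<bullet> \<pi>\<^sub>1 (cod f \<^bold>\<times> cod g) (cod h), \<pi>\<^sub>2 (cod f \<^bold>\<times> cod g) (cod h)\<rangle>\<rangle> \<bullet>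
      \<langle>\<langle>f, g\<rangle>, h\<rangle> = ident ((cod f \<^bold>\<times> cod g) \<^bold>\<times> cod h) \<bullet> \<langle>\<langle>f, g\<rangle>, h\<rangle>" by simp
  then show ?thesis using assms by simp
qed

lemma cross_eq: "cc_cross K f (ident C) = \<langle>f \<bullet> \<pi>\<^sub>1 (dom f) C, \<pi>\<^sub>2 (dom f) C\<rangle>"
  by (simp add: cc_cross_def)

section \<open>The dagger identities in pairing form\<close>

lemma dag_simps [simp]:
  assumes "arr f" "dom f = cod f \<^bold>\<times> C"
  shows "arr (dag C f)" "dom (dag C f) = C" "cod (dag C f) = cod f"
proof -
  have "\<forall>A C f. f \<in> Hom (A \<^bold>\<times> C) A \<longrightarrow> dag C f \<in> Hom C A"
    using conway unfolding is_conway_def by (elim conjE) assumption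
  from this[rule_format, of f "cod f" C] assms
  show "arr (dag C f)" "dom (dag C f) = C" "cod (dag C f) = cod f" by auto
qed

lemma dag_parameter:
  assumes "f \<in> Hom (A \<^bold>\<times> B) A" "g \<in> Hom C B"
  shows "dag C (f \<bullet> \<langle>\<pi>\<^sub>1 A C, g \<bullet> \<pi>\<^sub>2 A C\<rangle>) = dag B f \<bullet> g"
proof -
  have "\<forall>A B C f g. f \<in> Hom (A \<^bold>\<times> B) A \<longrightarrow> g \<in> Hom C B \<longrightarrow>
        dag C (f \<bullet> cc_cross K (ident A) g) = dag B f \<bullet> g"
    using conway unfolding is_conway_def by (elim conjE) assumption
  from this[rule_format, OF assms] show ?thesis using assms by (simp add: cc_cross_def)
qed

text \<open>Strict associativity turns \<Delta> \<times> 1 into a pairing whose two halves read the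
  same variable: the right side identifies the two copies of \<open>A\<close> in
  \<open>f\<close>.\<close>

lemma dag_double:
  assumes "f \<in> Hom (A \<^bold>\<times> A \<^bold>\<times> C) A"
  shows "dag C (dag (A \<^bold>\<times> C) f) = dag C (f \<bullet> \<langle>\<pi>\<^sub>1 A C, ident (A \<^bold>\<times> C)\<rangle>)"
proof -
  have "\<forall>A C f. f \<in> Hom (A \<^bold>\<times> A \<^bold>\<times> C) A \<longrightarrow>
        dag C (dag (A \<^bold>\<times> C) f) = dag C (f \<bullet> cc_cross K (cc_diag K A 2) (ident C))"
    using conway unfolding is_conway_def by (elim conjE) assumption
  from this[rule_format, OF assms] show ?thesis
    by (simp add: cc_cross_def cc_diag_def numeral_2_eq_2 pair_assoc)
qed

lemma dag_composition:
  assumes "f \<in> Hom (B \<^bold>\<times> C) A" "g \<in> Hom (A \<^bold>\<times> C) B"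
  shows "dag C (f \<bullet> \<langle>g, \<pi>\<^sub>2 A C\<rangle>) = f \<bullet> \<langle>dag C (g \<bullet> \<langle>f, \<pi>\<^sub>2 B C\<rangle>), ident C\<rangle>"
proof -
  have "\<forall>A B C f g. f \<in> Hom (B \<^bold>\<times> C) A \<longrightarrow> g \<in> Hom (A \<^bold>\<times> C) B \<longrightarrow>
     dag C (f \<bullet> \<langle>g, \<pi>\<^sub>2 A C\<rangle>) = f \<bullet> \<langle>dag C (g \<bullet> \<langle>f, \<pi>\<^sub>2 B C\<rangle>), ident C\<rangle>"
    using conway unfolding is_conway_def by (elim conjE) assumption
  from this[rule_format, OF assms] show ?thesis .
qed

text \<open>The composition identity with the first projection for \<open>g\<close>.\<close>

lemma dag_fixpoint:
  assumes "f \<in> Hom (A \<^bold>\<times> C) A"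
  shows "f \<bullet> \<langle>dag C f, ident C\<rangle> = dag C f"
  using dag_composition[OF assms, of "\<pi>\<^sub>1 A C"] assms by simp

text \<open>The composition identity with a first factor \<open>s\<close> that ignores the
  parameter. It trades a dagger over the codomain \<open>B\<close> of \<open>s\<close> for one over
  its domain \<open>A\<close>.\<close>

lemma dag_slide:
  assumes "s \<in> Hom A B" "h \<in> Hom (B \<^bold>\<times> C) A"
  shows "dag C (s \<bullet> h) = s \<bullet> dag C (h \<bullet> \<langle>s \<bullet> \<pi>\<^sub>1 A C, \<pi>\<^sub>2 A C\<rangle>)"
  using dag_composition[of "s \<bullet> \<pi>\<^sub>1 A C" A C B h] assms by simp

section \<open>Powers of an object\<close>

text \<open>Powers are described by their universal property instead of by \<open>cc_pow\<close>:
  products, function sets and sets of words can then serve directly as index sets, and one object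
  can be a power in several ways.\<close>

definition is_power :: "'o \<Rightarrow> 'i set \<Rightarrow> 'o \<Rightarrow> ('i \<Rightarrow> 'm) \<Rightarrow> bool" where
  "is_power A I P p \<longleftrightarrow> (\<forall>i\<in>I. p i \<in> Hom P A) \<and>
     (\<forall>Y g. (\<forall>i\<in>I. g i \<in> Hom Y A) \<longrightarrow> (\<exists>!u. u \<in> Hom Y P \<and> (\<forall>i\<in>I. p i \<bullet> u = g i)))"

text \<open>The argument \<open>A\<close> is not used in the definition: it makes the premise \<open>is_power A I P p\<close> of the
  rewrite rules below determined by their left-hand sides.\<close>

definition tupling :: "'o \<Rightarrow> 'i set \<Rightarrow> 'o \<Rightarrow> ('i \<Rightarrow> 'm) \<Rightarrow> 'o \<Rightarrow> ('i \<Rightarrow> 'm) \<Rightarrow> 'm" where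
  "tupling A I P p Y g = (THE u. u \<in> Hom Y P \<and> (\<forall>i\<in>I. p i \<bullet> u = g i))"

text \<open>Components are rewritten under the assumption \<open>i \<in> I\<close>, on which the
  typing rules for the projections depend.\<close>

lemma tupling_cong [cong]:
  "Y = Y' \<Longrightarrow> (\<And>i. i \<in> I \<Longrightarrow> g i = g' i) \<Longrightarrow> tupling A I P p Y g = tupling A I P p Y' g'"
  by (simp add: tupling_def)

lemma power_proj_simps:
  assumes "is_power A I P p" "i \<in> I"
  shows "arr (p i)" "dom (p i) = P" "cod (p i) = A"
  using assms by (auto simp: is_power_def)

lemma tupling_simps [simp]:
  assumes "is_power A I P p"
    and "\<And>i. i \<in> I \<Longrightarrow> arr (g i)" "\<And>i. i \<in> I \<Longrightarrow> dom (g i) = Y" "\<And>i. i \<in> I \<Longrightarrow> cod (g i) = A"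
  shows "arr (tupling A I P p Y g)" "dom (tupling A I P p Y g) = Y" "cod (tupling A I P p Y g) = P"
    "i \<in> I \<Longrightarrow> p i \<bullet> tupling A I P p Y g = g i"
proof -
  have "\<exists>!u. u \<in> Hom Y P \<and> (\<forall>i\<in>I. p i \<bullet> u = g i)"
    using assms unfolding is_power_def by (elim conjE allE[of _ Y] allE[of _ g]) simp
  from theI'[OF this, folded tupling_def[of A I P p Y g]] show "arr (tupling A I P p Y g)" "dom (tupling A I P p Y g) = Y"
    "cod (tupling A I P p Y g) = P" "i \<in> I \<Longrightarrow> p i \<bullet> tupling A I P p Y g = g i"
    by auto
qed

lemma power_eqI:
  assumes P: "is_power A I P p" and u: "u \<in> Hom Y P" and v: "v \<in> Hom Y P"
    and eq: "\<And>i. i \<in> I \<Longrightarrow> p i \<bullet> u = p i \<bullet> v"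
  shows "u = v"
proof -
  have "\<forall>Y g. (\<forall>i\<in>I. g i \<in> Hom Y A) \<longrightarrow> (\<exists>!u. u \<in> Hom Y P \<and> (\<forall>i\<in>I. p i \<bullet> u = g i))"
    using P unfolding is_power_def by (rule conjunct2)
  moreover have "\<forall>i\<in>I. p i \<bullet> u \<in> Hom Y A" using power_proj_simps[OF P] u by simp
  ultimately have "\<exists>!x. x \<in> Hom Y P \<and> (\<forall>i\<in>I. p i \<bullet> x = p i \<bullet> u)" by (elim allE impE)
  then show ?thesis using u v eq by (elim ex1E) (auto simp del: Hom_iff)
qed

lemma is_powerI:
  assumes "\<And>i. i \<in> I \<Longrightarrow> p i \<in> Hom P A"
    and "\<And>Y g. (\<And>i. i \<in> I \<Longrightarrow> g i \<in> Hom Y A) \<Longrightarrow> \<exists>u\<in>Hom Y P. \<forall>i\<in>I. p i \<bullet> u = g i"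
    and "\<And>Y u v. u \<in> Hom Y P \<Longrightarrow> v \<in> Hom Y P \<Longrightarrow> (\<And>i. i \<in> I \<Longrightarrow> p i \<bullet> u = p i \<bullet> v) \<Longrightarrow> u = v"
  shows "is_power A I P p"
  unfolding is_power_def
proof (intro conjI allI impI ballI)
  fix Y g assume g: "\<forall>i\<in>I. g i \<in> Hom Y A"
  then obtain u where "u \<in> Hom Y P" "\<forall>i\<in>I. p i \<bullet> u = g i" using assms(2)[of g Y] by blast
  then show "\<exists>!u. u \<in> Hom Y P \<and> (\<forall>i\<in>I. p i \<bullet> u = g i)"
    using assms(3)[of _ Y] by (intro ex1I[of _ u]) auto
qed (use assms(1) in auto)

text \<open>Composites are kept nested to the right, so an equation for \<open>h \<bullet> g\<close>
  has to be restated with a tail \<open>x\<close> before it can be applied inside a longer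
  composite.\<close>

lemma comp_reassoc:
  assumes "h \<bullet> g = k" "arr x" "arr g" "arr h" "cod x = dom g" "cod g = dom h"
  shows "h \<bullet> g \<bullet> x = k \<bullet> x"
  using comp_assoc[of x g h] assms by simp

lemma tupling_comp [simp]:
  assumes P: "is_power A I P p" and x: "arr x" "cod x = Y"
    and g: "\<And>i. i \<in> I \<Longrightarrow> arr (g i)" "\<And>i. i \<in> I \<Longrightarrow> dom (g i) = Y" "\<And>i. i \<in> I \<Longrightarrow> cod (g i) = A"
  shows "tupling A I P p Y g \<bullet> x = tupling A I P p (dom x) (\<lambda>i. g i \<bullet> x)"
proof (rule power_eqI[OF P, of _ "dom x"])
  note [simp] = P x g power_proj_simps[OF P]
  fix i assume i: "i \<in> I"
  show "p i \<bullet> tupling A I P p Y g \<bullet> x = p i \<bullet> tupling A I P p (dom x) (\<lambda>i. g i \<bullet> x)"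
    using i by (subst comp_reassoc[where k = "g i"]) auto
qed (use assms in auto)

section \<open>Existence of finite powers, iterated powers and the chosen powers\<close>

lemma power_empty: "is_power A {} (cc_term K) p"
proof (rule is_powerI)
  have 1: "\<forall>A. cc_bang K A \<in> Hom A (cc_term K)"
    using cartesian unfolding is_cartesian_def by (elim conjE) assumption
  have 2: "\<forall>A f. f \<in> Hom A (cc_term K) \<longrightarrow> f = cc_bang K A"
    using cartesian unfolding is_cartesian_def by (elim conjE) assumption
  show "\<exists>u\<in>Hom Y (cc_term K). \<forall>i\<in>{}. p i \<bullet> u = g i" for Y g using 1 by blast
  show "u = v" if "u \<in> Hom Y (cc_term K)" "v \<in> Hom Y (cc_term K)" for Y u v
    using 2 that by blast
qed auto

lemma power_insert:
  assumes P: "is_power A I P p" and i: "i \<notin> I"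
  shows "is_power A (insert i I) (A \<^bold>\<times> P) (\<lambda>j. if j = i then \<pi>\<^sub>1 A P else p j \<bullet> \<pi>\<^sub>2 A P)"
proof (rule is_powerI)
  note [simp] = P power_proj_simps[OF P]
  let ?p = "\<lambda>j. if j = i then \<pi>\<^sub>1 A P else p j \<bullet> \<pi>\<^sub>2 A P"
  show "?p j \<in> Hom (A \<^bold>\<times> P) A" if "j \<in> insert i I" for j using that by auto
  show "\<exists>u\<in>Hom Y (A \<^bold>\<times> P). \<forall>j\<in>insert i I. ?p j \<bullet> u = g j"
    if "\<And>j. j \<in> insert i I \<Longrightarrow> g j \<in> Hom Y A" for Y g
    using that i by (intro bexI[of _ "\<langle>g i, tupling A I P p Y g\<rangle>"]) auto
  show "u = v" if u: "u \<in> Hom Y (A \<^bold>\<times> P)" and v: "v \<in> Hom Y (A \<^bold>\<times> P)"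
    and eq: "\<And>j. j \<in> insert i I \<Longrightarrow> ?p j \<bullet> u = ?p j \<bullet> v" for Y u v
  proof -
    have 1: "\<pi>\<^sub>1 A P \<bullet> u = \<pi>\<^sub>1 A P \<bullet> v" using eq[of i] by simp
    have "\<pi>\<^sub>2 A P \<bullet> u = \<pi>\<^sub>2 A P \<bullet> v"
    proof (rule power_eqI[OF P, of _ Y])
      fix j assume j: "j \<in> I"
      with i have "j \<noteq> i" by auto
      with eq[of j] j u v show "p j \<bullet> \<pi>\<^sub>2 A P \<bullet> u = p j \<bullet> \<pi>\<^sub>2 A P \<bullet> v" by simp
    qed (use u v in auto)
    with 1 show "u = v" using u v by (intro pair_eqI[of u Y A P v])
  qed
qed

lemma power_exists:
  assumes "finite I"
  shows "\<exists>P p. is_power A I P p"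
  using assms by induction (blast intro: power_empty power_insert)+

text \<open>\<open>R\<close> gets two readings, as a power of \<open>P\<close> and as a power of
  \<open>A\<close>; this lets a system over the object \<open>P\<close> be reread as a larger system
  over \<open>A\<close>.\<close>

lemma power_power:
  assumes P: "is_power A S P s" and R: "is_power P I R q"
  shows "is_power A (I \<times> S) R (\<lambda>(i, u). s u \<bullet> q i)"
proof (rule is_powerI)
  note [simp] = P R power_proj_simps[OF P] power_proj_simps[OF R]
  show "(case j of (i, u) \<Rightarrow> s u \<bullet> q i) \<in> Hom R A" if "j \<in> I \<times> S" for j using that by auto
  show "\<exists>u\<in>Hom Y R. \<forall>j\<in>I \<times> S. (case j of (i, u) \<Rightarrow> s u \<bullet> q i) \<bullet> u = g j"
    if "\<And>j. j \<in> I \<times> S \<Longrightarrow> g j \<in> Hom Y A" for Y g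
    using that
    by (intro bexI[of _ "tupling P I R q Y (\<lambda>i. tupling A S P s Y (\<lambda>u. g (i, u)))"]) auto
  show "u = v" if "u \<in> Hom Y R" "v \<in> Hom Y R" and
    eq: "\<And>j. j \<in> I \<times> S \<Longrightarrow> (case j of (i, u) \<Rightarrow> s u \<bullet> q i) \<bullet> u = (case j of (i, u) \<Rightarrow> s u \<bullet> q i) \<bullet> v" for Y u v
  proof (rule power_eqI[OF R that(1,2)], rule power_eqI[OF P, of _ Y])
    show "s k \<bullet> q i \<bullet> u = s k \<bullet> q i \<bullet> v" if "i \<in> I" "k \<in> S" for i k
      using eq[of "(i, k)"] that \<open>u \<in> Hom Y R\<close> \<open>v \<in> Hom Y R\<close> by simp
  qed (use that in auto)
qed

text \<open>Lengths are written \<open>Suc n\<close> because \<open>cc_tupN\<close> and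
  \<open>cc_proj\<close> are \<open>undefined\<close> at 0.\<close>

lemma tupN_facts:
  assumes "\<And>i. i < Suc n \<Longrightarrow> g i \<in> Hom Y A"
  shows "cc_tupN K (Suc n) g \<in> Hom Y (cc_pow K A (Suc n))"
    and "i < Suc n \<Longrightarrow> cc_proj K A (Suc n) i \<in> Hom (cc_pow K A (Suc n)) A"
    and "i < Suc n \<Longrightarrow> cc_proj K A (Suc n) i \<bullet> cc_tupN K (Suc n) g = g i"
proof -
  have "cc_tupN K (Suc n) g \<in> Hom Y (cc_pow K A (Suc n)) \<and> (\<forall>i<Suc n.
      cc_proj K A (Suc n) i \<in> Hom (cc_pow K A (Suc n)) A \<and>
      cc_proj K A (Suc n) i \<bullet> cc_tupN K (Suc n) g = g i)"
    using assms
  proof (induction n arbitrary: g)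
    case (Suc n)
    have IH: "cc_tupN K (Suc n) (\<lambda>i. g (Suc i)) \<in> Hom Y (cc_pow K A (Suc n))"
      "\<forall>i<Suc n. cc_proj K A (Suc n) i \<in> Hom (cc_pow K A (Suc n)) A \<and>
        cc_proj K A (Suc n) i \<bullet> cc_tupN K (Suc n) (\<lambda>i. g (Suc i)) = g (Suc i)"
      using Suc.IH[of "\<lambda>i. g (Suc i)"] Suc.prems by auto
    have g0: "g 0 \<in> Hom Y A" using Suc.prems by blast
    show ?case
    proof (intro conjI allI impI)
      show "cc_tupN K (Suc (Suc n)) g \<in> Hom Y (cc_pow K A (Suc (Suc n)))"
        using IH(1) g0 by simp
      fix i assume i: "i < Suc (Suc n)"
      show "cc_proj K A (Suc (Suc n)) i \<in> Hom (cc_pow K A (Suc (Suc n))) A"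
        using i IH(2) by (cases i) auto
      show "cc_proj K A (Suc (Suc n)) i \<bullet> cc_tupN K (Suc (Suc n)) g = g i"
        using i IH g0 by (cases i) auto
    qed
  qed auto
  then show "cc_tupN K (Suc n) g \<in> Hom Y (cc_pow K A (Suc n))"
    and "i < Suc n \<Longrightarrow> cc_proj K A (Suc n) i \<in> Hom (cc_pow K A (Suc n)) A"
    and "i < Suc n \<Longrightarrow> cc_proj K A (Suc n) i \<bullet> cc_tupN K (Suc n) g = g i" by blast+
qed

lemma power_pow:
  assumes "n \<ge> 1"
  shows "is_power A {0..<n} (cc_pow K A n) (cc_proj K A n)"
proof -
  obtain k where n: "n = Suc k" using assms by (cases n) auto
  show ?thesis
  proof (rule is_powerI)
    show "cc_proj K A n i \<in> Hom (cc_pow K A n) A" if "i \<in> {0..<n}" for i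
      using tupN_facts(2)[of k "\<lambda>_. ident A" A A i] that n by simp
    show "\<exists>u\<in>Hom Y (cc_pow K A n). \<forall>i\<in>{0..<n}. cc_proj K A n i \<bullet> u = g i"
      if "\<And>i. i \<in> {0..<n} \<Longrightarrow> g i \<in> Hom Y A" for Y g
      using tupN_facts[of k g Y A] that unfolding n by (intro bexI[of _ "cc_tupN K (Suc k) g"]) auto
    show "u = v" if "u \<in> Hom Y (cc_pow K A n)" "v \<in> Hom Y (cc_pow K A n)"
      "\<And>i. i \<in> {0..<n} \<Longrightarrow> cc_proj K A n i \<bullet> u = cc_proj K A n i \<bullet> v" for Y u v
      using that unfolding n
    proof (induction k arbitrary: u v)
      case (Suc k)
      have pr: "cc_proj K A (Suc k) i \<in> Hom (cc_pow K A (Suc k)) A" if "i < Suc k" for i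
        using tupN_facts(2)[of k "\<lambda>_. ident A" A A i] that by simp
      have "\<pi>\<^sub>2 A (cc_pow K A (Suc k)) \<bullet> u = \<pi>\<^sub>2 A (cc_pow K A (Suc k)) \<bullet> v"
      proof (rule Suc.IH)
        fix i assume i: "i \<in> {0..<Suc k}"
        then show "cc_proj K A (Suc k) i \<bullet> \<pi>\<^sub>2 A (cc_pow K A (Suc k)) \<bullet> u =
          cc_proj K A (Suc k) i \<bullet> \<pi>\<^sub>2 A (cc_pow K A (Suc k)) \<bullet> v"
          using Suc.prems(3)[of "Suc i"] pr[of i] Suc.prems(1,2) by simp
      qed (use Suc.prems(1,2) in auto)
      moreover have "\<pi>\<^sub>1 A (cc_pow K A (Suc k)) \<bullet> u = \<pi>\<^sub>1 A (cc_pow K A (Suc k)) \<bullet> v"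
        using Suc.prems(3)[of 0] by simp
      ultimately show ?case
        using Suc.prems(1,2) by (intro pair_eqI[of u Y A "cc_pow K A (Suc k)" v]) simp_all
    qed simp
  qed
qed

lemma tupN_eq_tupling:
  assumes "n \<ge> 1" "\<And>i. i < n \<Longrightarrow> g i \<in> Hom Y A"
  shows "cc_tupN K n g = tupling A {0..<n} (cc_pow K A n) (cc_proj K A n) Y g"
proof -
  obtain k where n: "n = Suc k" using assms(1) by (cases n) auto
  have g: "g i \<in> Hom Y A" if "i < Suc k" for i using assms(2) that n by simp
  note t = tupN_facts[of k g Y A, OF g, folded n]
  define I where "I = {0..<n}"
  have g_simps: "arr (g i)" "dom (g i) = Y" "cod (g i) = A" if "i \<in> I" for i
    using assms(2)[of i] that by (auto simp: I_def)
  have P: "is_power A I (cc_pow K A n) (cc_proj K A n)"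
    using power_pow[OF assms(1), of A] by (simp only: I_def)
  have "cc_tupN K n g = tupling A I (cc_pow K A n) (cc_proj K A n) Y g"
  proof (rule power_eqI[OF P t(1)])
    show "cc_proj K A n i \<bullet> cc_tupN K n g =
      cc_proj K A n i \<bullet> tupling A I (cc_pow K A n) (cc_proj K A n) Y g" if "i \<in> I" for i
      using that P t(3)[of i] by (simp add: g_simps) (simp add: I_def)
  qed (use P in \<open>simp_all add: g_simps\<close>)
  then show ?thesis by (simp only: I_def)
qed

section \<open>Reindexing and elimination\<close>

text \<open>Split the variable of \<open>F\<close> into two copies, feeding the first one to the components in the range of
  \<open>\<phi>\<close> and the second one to the others: the first copy is then only used through \<open>\<sigma>\<close>.\<close>

lemma dag_reindex:
  assumes P: "is_power A I P p" and P': "is_power A J P' p'"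
    and \<phi>: "inj_on \<phi> J" "\<phi> ` J \<subseteq> I"
    and F: "F \<in> Hom (P \<^bold>\<times> C) P" and F': "F' \<in> Hom (P' \<^bold>\<times> C) P'"
    and sim: "\<And>j. j \<in> J \<Longrightarrow> p (\<phi> j) \<bullet> F =
      p' j \<bullet> F' \<bullet> \<langle>tupling A J P' p' (P \<^bold>\<times> C) (\<lambda>j. p (\<phi> j) \<bullet> \<pi>\<^sub>1 P C), \<pi>\<^sub>2 P C\<rangle>"
    and j: "j \<in> J"
  shows "p (\<phi> j) \<bullet> dag C F = p' j \<bullet> dag C F'"
proof -
  define \<sigma> where "\<sigma> = tupling A J P' p' P (\<lambda>j. p (\<phi> j))"
  define D where "D = P \<^bold>\<times> C"
  \<comment> \<open>\<open>D\<close> contains the second copy of \<open>P\<close>. The first copy is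
    already cut down to \<open>P'\<close>, which is all that the components in the range of
    \<open>\<phi>\<close> read.\<close>
  define g where "g i = (if i \<in> \<phi> ` J
    then p' (inv_into J \<phi> i) \<bullet> F' \<bullet> \<langle>\<pi>\<^sub>1 P' D, \<pi>\<^sub>2 P C \<bullet> \<pi>\<^sub>2 P' D\<rangle> else p i \<bullet> F \<bullet> \<pi>\<^sub>2 P' D)" for i
  define h where "h = tupling A I P p (P' \<^bold>\<times> D) g"
  have \<phi>I: "\<phi> j \<in> I" if "j \<in> J" for j using \<phi>(2) that by auto
  note [simp] = P P' power_proj_simps[OF P] power_proj_simps[OF P'] \<phi>I
  have D [simp]: "P \<^bold>\<times> C = D" by (simp add: D_def)
  have F'_simps [simp]: "arr F'" "dom F' = P' \<^bold>\<times> C" "cod F' = P'" using F' by auto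
  have F_simps [simp]: "arr F" "dom F = D" "cod F = P" using F by auto
  have \<sigma> [simp]: "arr \<sigma>" "dom \<sigma> = P" "cod \<sigma> = P'" by (simp_all add: \<sigma>_def)
  have p\<sigma>: "p' j \<bullet> \<sigma> \<bullet> y = p (\<phi> j) \<bullet> y" if "arr y" "cod y = P" "j \<in> J" for j y
    using that by (intro comp_reassoc) (auto simp: \<sigma>_def)
  have g_in: "g (\<phi> j) = p' j \<bullet> F' \<bullet> \<langle>\<pi>\<^sub>1 P' D, \<pi>\<^sub>2 P C \<bullet> \<pi>\<^sub>2 P' D\<rangle>" if "j \<in> J" for j
    using that \<phi>(1) by (simp add: g_def)
  have g_out: "g i = p i \<bullet> F \<bullet> \<pi>\<^sub>2 P' D" if "i \<notin> \<phi> ` J" for i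
    using that by (simp add: g_def)
  have g_Hom: "g i \<in> Hom (P' \<^bold>\<times> D) A" if "i \<in> I" for i
  proof (cases "i \<in> \<phi> ` J")
    case True
    then obtain j where "j \<in> J" "i = \<phi> j" by auto
    then show ?thesis by (simp add: g_in)
  qed (use that in \<open>simp add: g_out\<close>)
  have g_simps [simp]: "arr (g i)" "dom (g i) = P' \<^bold>\<times> D" "cod (g i) = A" if "i \<in> I" for i
    using g_Hom[OF that] by auto
  have h [simp]: "arr h" "dom h = P' \<^bold>\<times> D" "cod h = P" by (simp_all add: h_def)
  have ph: "p i \<bullet> h \<bullet> y = g i \<bullet> y" if "arr y" "cod y = P' \<^bold>\<times> D" "i \<in> I" for i y
    using that by (intro comp_reassoc) (auto simp: h_def)
  \<comment> \<open>The coordinates kept by \<open>\<sigma>\<close> no longer see the copy of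
    \<open>P\<close> inside \<open>D\<close>: only \<open>F'\<close> in its own variable and the
    parameter from \<open>C\<close> remain.\<close>
  have hF': "\<sigma> \<bullet> h = F' \<bullet> \<langle>\<pi>\<^sub>1 P' D, \<pi>\<^sub>2 P C \<bullet> \<pi>\<^sub>2 P' D\<rangle>"
  proof (rule power_eqI[OF P', of _ "P' \<^bold>\<times> D"])
    fix j assume j: "j \<in> J"
    then show "p' j \<bullet> \<sigma> \<bullet> h = p' j \<bullet> F' \<bullet> \<langle>\<pi>\<^sub>1 P' D, \<pi>\<^sub>2 P C \<bullet> \<pi>\<^sub>2 P' D\<rangle>"
      using p\<sigma>[of h j] by (simp add: g_in[symmetric]) (simp add: h_def)
  qed auto
  define \<Phi> where "\<Phi> = h \<bullet> \<langle>\<sigma> \<bullet> \<pi>\<^sub>1 P D, \<pi>\<^sub>2 P D\<rangle>"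
  have \<Phi> [simp]: "arr \<Phi>" "dom \<Phi> = P \<^bold>\<times> D" "cod \<Phi> = P" by (simp_all add: \<Phi>_def)
  \<comment> \<open>\<open>dag_slide\<close> turns the left side into the dagger of
    \<open>\<sigma> \<bullet> h\<close>, and the parameter identity then extracts the projection to
    \<open>C\<close>.\<close>
  have \<sigma>\<Phi>: "\<sigma> \<bullet> dag D \<Phi> = dag C F' \<bullet> \<pi>\<^sub>2 P C"
    unfolding \<Phi>_def using dag_slide[of \<sigma> P P' h D] hF' dag_parameter[OF F', of "\<pi>\<^sub>2 P C" D] by simp
  \<comment> \<open>Identifying the two copies gives back \<open>F\<close>; on the range of
    \<open>\<phi>\<close> this is the hypothesis \<open>sim\<close>.\<close>
  have "\<Phi> \<bullet> \<langle>\<pi>\<^sub>1 P C, ident D\<rangle> = F"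
  proof (rule power_eqI[OF P, of _ D])
    fix i assume i: "i \<in> I"
    have 1: "p i \<bullet> \<Phi> \<bullet> \<langle>\<pi>\<^sub>1 P C, ident D\<rangle> = g i \<bullet> \<langle>\<sigma> \<bullet> \<pi>\<^sub>1 P C, ident D\<rangle>"
      using i by (simp add: \<Phi>_def ph)
    show "p i \<bullet> \<Phi> \<bullet> \<langle>\<pi>\<^sub>1 P C, ident D\<rangle> = p i \<bullet> F"
    proof (cases "i \<in> \<phi> ` J")
      case True
      then obtain j where j: "j \<in> J" "i = \<phi> j" by auto
      have "\<sigma> \<bullet> \<pi>\<^sub>1 P C = tupling A J P' p' D (\<lambda>j. p (\<phi> j) \<bullet> \<pi>\<^sub>1 P C)"
        by (simp add: \<sigma>_def)
      with sim[OF j(1)] j 1 show ?thesis by (simp add: g_in)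
    next
      case False
      with i 1 show ?thesis by (simp add: g_out)
    qed
  qed auto
  then have FF: "dag C F = dag C (dag D \<Phi>)"
    using dag_double[of \<Phi> P C] by simp
  have d\<Phi>: "dag D \<Phi> \<in> Hom (P \<^bold>\<times> C) P" by simp
  \<comment> \<open>One unfolding of the outer dagger suffices, because by
    \<open>\<sigma>\<Phi>\<close> the \<open>\<sigma>\<close> part of the inner dagger does not
    depend on the outer variable.\<close>
  have "\<sigma> \<bullet> dag C F = \<sigma> \<bullet> dag D \<Phi> \<bullet> \<langle>dag C F, ident C\<rangle>"
    using dag_fixpoint[OF d\<Phi>] by (simp add: FF)
  also have "\<dots> = (dag C F' \<bullet> \<pi>\<^sub>2 P C) \<bullet> \<langle>dag C F, ident C\<rangle>"
    by (intro comp_reassoc[OF \<sigma>\<Phi>]) auto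
  also have "\<dots> = dag C F'" by simp
  finally show ?thesis using p\<sigma>[of "dag C F" j] j by simp
qed

text \<open>Each unknown outside the core is an alias of an unknown of smaller rank. After doubling the variable,
  the inner dagger is computed by the fixed point identity alone, as the core components of the doubled
  system do not depend on the inner variable.\<close>

lemma dag_eliminate:
  fixes x :: "'t \<Rightarrow> 'm" and rank :: "'t \<Rightarrow> nat"
  assumes R: "is_power A T R x" and \<sigma>: "\<sigma> \<in> Hom B R" and \<psi>: "\<psi> \<in> Hom (R \<^bold>\<times> C) B"
    and F: "F \<in> Hom (R \<^bold>\<times> C) R"
    and core: "\<And>t. t \<in> T \<Longrightarrow> core t \<Longrightarrow> x t \<bullet> F = x t \<bullet> \<sigma> \<bullet> \<psi>"
    and next_in: "\<And>t. t \<in> T \<Longrightarrow> \<not> core t \<Longrightarrow> nxt t \<in> T"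
    and next_rank: "\<And>t. t \<in> T \<Longrightarrow> \<not> core t \<Longrightarrow> rank (nxt t) < rank t"
    and next_F: "\<And>t. t \<in> T \<Longrightarrow> \<not> core t \<Longrightarrow> x t \<bullet> F = x (nxt t) \<bullet> \<pi>\<^sub>1 R C"
    and next_\<sigma>: "\<And>t. t \<in> T \<Longrightarrow> \<not> core t \<Longrightarrow> x t \<bullet> \<sigma> = x (nxt t) \<bullet> \<sigma>"
  shows "dag C F = \<sigma> \<bullet> dag C (\<psi> \<bullet> \<langle>\<sigma> \<bullet> \<pi>\<^sub>1 B C, \<pi>\<^sub>2 B C\<rangle>)"
proof -
  define D where "D = R \<^bold>\<times> C"
  have D [simp]: "R \<^bold>\<times> C = D" by (simp add: D_def)
  note [simp] = R power_proj_simps[OF R] next_in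
  have [simp]: "arr \<sigma>" "dom \<sigma> = B" "cod \<sigma> = R" "arr \<psi>" "dom \<psi> = D" "cod \<psi> = B"
    "arr F" "dom F = D" "cod F = R"
    using \<sigma> \<psi> F by auto
  \<comment> \<open>Aliases read the inner variable, core components the outer copy of
    \<open>R\<close> inside \<open>D\<close>. The map \<open>\<psi>\<close> computes values in
    \<open>B\<close>, from which \<open>\<sigma>\<close> recovers all unknowns.\<close>
  define g where "g t = (if core t then x t \<bullet> \<sigma> \<bullet> \<psi> \<bullet> \<pi>\<^sub>2 R D else x (nxt t) \<bullet> \<pi>\<^sub>1 R D)" for t
  have [simp]: "arr (g t)" "dom (g t) = R \<^bold>\<times> D" "cod (g t) = A" if "t \<in> T" for t
    using that by (auto simp: g_def)
  define \<Phi> where "\<Phi> = tupling A T R x (R \<^bold>\<times> D) g"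
  have [simp]: "arr \<Phi>" "dom \<Phi> = R \<^bold>\<times> D" "cod \<Phi> = R" by (simp_all add: \<Phi>_def)
  have x\<Phi>: "x t \<bullet> \<Phi> \<bullet> y = g t \<bullet> y" if "arr y" "cod y = R \<^bold>\<times> D" "t \<in> T" for t y
    using that by (intro comp_reassoc) (auto simp: \<Phi>_def)
  have fix\<Phi>: "x t \<bullet> dag D \<Phi> = g t \<bullet> \<langle>dag D \<Phi>, ident D\<rangle>" if "t \<in> T" for t
    using dag_fixpoint[of \<Phi> R D] x\<Phi>[of "\<langle>dag D \<Phi>, ident D\<rangle>" t] that by simp
  \<comment> \<open>Along an alias both sides pass to \<open>nxt t\<close>, the right one by
    \<open>next_\<sigma>\<close>, so induction on \<open>rank\<close> descends to the core.\<close>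
  have "dag D \<Phi> = \<sigma> \<bullet> \<psi>"
  proof (rule power_eqI[OF R, of _ D])
    fix t assume "t \<in> T"
    then show "x t \<bullet> dag D \<Phi> = x t \<bullet> \<sigma> \<bullet> \<psi>"
    proof (induction t rule: measure_induct_rule[of rank])
      case (less t)
      show ?case
      proof (cases "core t")
        case True
        with fix\<Phi>[of t] less.prems show ?thesis by (simp add: g_def)
      next
        case False
        have "x t \<bullet> dag D \<Phi> = x (nxt t) \<bullet> dag D \<Phi>"
          using fix\<Phi>[of t] less.prems False by (simp add: g_def)
        also have "\<dots> = x (nxt t) \<bullet> \<sigma> \<bullet> \<psi>"
          using less.IH less.prems False next_rank by simp
        also have "\<dots> = (x t \<bullet> \<sigma>) \<bullet> \<psi>"
          using less.prems False by (simp add: next_\<sigma> del: comp_assoc) simp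
        finally show ?thesis using less.prems by simp
      qed
    qed
  qed auto
  moreover have "\<Phi> \<bullet> \<langle>\<pi>\<^sub>1 R C, ident D\<rangle> = F"
  proof (rule power_eqI[OF R, of _ D])
    fix t assume "t \<in> T"
    then show "x t \<bullet> \<Phi> \<bullet> \<langle>\<pi>\<^sub>1 R C, ident D\<rangle> = x t \<bullet> F"
      by (cases "core t") (simp_all add: x\<Phi> g_def core next_F)
  qed auto
  ultimately have "dag C F = dag C (\<sigma> \<bullet> \<psi>)"
    using dag_double[of \<Phi> R C] by simp
  \<comment> \<open>Sliding \<open>\<sigma>\<close> out moves the remaining dagger from
    \<open>R\<close> to \<open>B\<close>.\<close>
  then show ?thesis using dag_slide[OF \<sigma> \<psi>] by simp
qed

section \<open>Systems of automata\<close>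

definition closed_action :: "'i set \<Rightarrow> 'z set \<Rightarrow> ('i \<Rightarrow> 'z \<Rightarrow> 'i) \<Rightarrow> bool" where
  "closed_action I Z \<delta> \<longleftrightarrow> (\<forall>i\<in>I. \<forall>z\<in>Z. \<delta> i z \<in> I)"

text \<open>\<open>F\<close> is f^Q for arbitrary choices of the powers \<open>P\<close> (states)
  and \<open>W\<close> (letters). It is fixed by its components, each being \<open>f\<close>
  composed with \<rho>_i \<times> 1.\<close>

definition aut_system :: "'o \<Rightarrow> 'o \<Rightarrow> 'i set \<Rightarrow> 'z set \<Rightarrow> ('i \<Rightarrow> 'z \<Rightarrow> 'i) \<Rightarrow>
    'o \<Rightarrow> ('i \<Rightarrow> 'm) \<Rightarrow> 'o \<Rightarrow> ('z \<Rightarrow> 'm) \<Rightarrow> 'm \<Rightarrow> 'm \<Rightarrow> bool" where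
  "aut_system A C I Z \<delta> P p W w f F \<longleftrightarrow>
     is_power A I P p \<and> is_power A Z W w \<and> f \<in> Hom (W \<^bold>\<times> C) A \<and> F \<in> Hom (P \<^bold>\<times> C) P \<and>
     (\<forall>i\<in>I. p i \<bullet> F =
        f \<bullet> \<langle>tupling A Z W w (P \<^bold>\<times> C) (\<lambda>z. p (\<delta> i z) \<bullet> \<pi>\<^sub>1 P C), \<pi>\<^sub>2 P C\<rangle>)"

text \<open>The identity \<Gamma> over all choices of the powers; comparing single components takes
  the place of the diagonal on its right side.\<close>

definition Gamma_identity :: "'i set \<Rightarrow> 'z set \<Rightarrow> ('i \<Rightarrow> 'z \<Rightarrow> 'i) \<Rightarrow> bool" where
  "Gamma_identity I Z \<delta> \<longleftrightarrow> (\<forall>A C P p W w f F. aut_system A C I Z \<delta> P p W w f F \<longrightarrow>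
     (\<forall>i\<in>I. p i \<bullet> dag C F =
        dag C (f \<bullet> \<langle>tupling A Z W w (A \<^bold>\<times> C) (\<lambda>z. \<pi>\<^sub>1 A C), \<pi>\<^sub>2 A C\<rangle>)))"

lemma Gamma_identityI:
  assumes "\<And>A C P p W w f F i. aut_system A C I Z \<delta> P p W w f F \<Longrightarrow> i \<in> I \<Longrightarrow>
    p i \<bullet> dag C F = dag C (f \<bullet> \<langle>tupling A Z W w (A \<^bold>\<times> C) (\<lambda>z. \<pi>\<^sub>1 A C), \<pi>\<^sub>2 A C\<rangle>)"
  shows "Gamma_identity I Z \<delta>"
  using assms unfolding Gamma_identity_def by blast

lemma Gamma_identityD:
  assumes "Gamma_identity I Z \<delta>" "aut_system A C I Z \<delta> P p W w f F" "i \<in> I"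
  shows "p i \<bullet> dag C F = dag C (f \<bullet> \<langle>tupling A Z W w (A \<^bold>\<times> C) (\<lambda>z. \<pi>\<^sub>1 A C), \<pi>\<^sub>2 A C\<rangle>)"
  using assms unfolding Gamma_identity_def by blast

lemma closed_actionD: "closed_action I Z \<delta> \<Longrightarrow> i \<in> I \<Longrightarrow> z \<in> Z \<Longrightarrow> \<delta> i z \<in> I"
  by (auto simp: closed_action_def)

lemma aut_systemD:
  assumes "aut_system A C I Z \<delta> P p W w f F"
  shows "is_power A I P p" "is_power A Z W w"
    "arr f" "dom f = W \<^bold>\<times> C" "cod f = A" "arr F" "dom F = P \<^bold>\<times> C" "cod F = P"
    "i \<in> I \<Longrightarrow> p i \<bullet> F = f \<bullet> \<langle>tupling A Z W w (P \<^bold>\<times> C) (\<lambda>z. p (\<delta> i z) \<bullet> \<pi>\<^sub>1 P C), \<pi>\<^sub>2 P C\<rangle>"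
  using assms by (auto simp: aut_system_def)

lemma aut_system_exists:
  assumes P: "is_power A I P p" and W: "is_power A Z W w" and f: "f \<in> Hom (W \<^bold>\<times> C) A"
    and cl: "closed_action I Z \<delta>"
  shows "\<exists>F. aut_system A C I Z \<delta> P p W w f F"
proof -
  note [simp] = P W power_proj_simps[OF P] power_proj_simps[OF W] closed_actionD[OF cl]
  have [simp]: "arr f" "dom f = W \<^bold>\<times> C" "cod f = A" using f by auto
  have "aut_system A C I Z \<delta> P p W w f (tupling A I P p (P \<^bold>\<times> C)
    (\<lambda>i. f \<bullet> \<langle>tupling A Z W w (P \<^bold>\<times> C) (\<lambda>z. p (\<delta> i z) \<bullet> \<pi>\<^sub>1 P C), \<pi>\<^sub>2 P C\<rangle>))"
    by (simp add: aut_system_def)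
  then show ?thesis by blast
qed

text \<open>As \<open>\<phi>\<close> commutes with the actions, the equations of states in its range
  mention only such states, and \<open>dag_reindex\<close> applies. With the identity for
  \<open>\<phi>\<close> it shows that the solution does not depend on the choice of the
  power.\<close>

lemma aut_system_dag_inj:
  assumes S: "aut_system A C I Z \<delta> P p W w f F" and S': "aut_system A C J Z \<delta>' P' p' W w f F'"
    and cl: "closed_action I Z \<delta>" and cl': "closed_action J Z \<delta>'"
    and \<phi>: "inj_on \<phi> J" "\<phi> ` J \<subseteq> I"
    and hom: "\<And>j z. j \<in> J \<Longrightarrow> z \<in> Z \<Longrightarrow> \<phi> (\<delta>' j z) = \<delta> (\<phi> j) z" and j: "j \<in> J"
  shows "p (\<phi> j) \<bullet> dag C F = p' j \<bullet> dag C F'"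
proof (rule dag_reindex[OF aut_systemD(1)[OF S] aut_systemD(1)[OF S'] \<phi> _ _ _ j])
  note [simp] = aut_systemD(1-8)[OF S] aut_systemD(1-8)[OF S'] closed_actionD[OF cl] closed_actionD[OF cl']
    power_proj_simps[OF aut_systemD(1)[OF S]] power_proj_simps[OF aut_systemD(1)[OF S']]
    power_proj_simps[OF aut_systemD(2)[OF S]]
  have \<phi>I [simp]: "\<phi> j \<in> I" if "j \<in> J" for j using \<phi>(2) that by auto
  show "F \<in> Hom (P \<^bold>\<times> C) P" "F' \<in> Hom (P' \<^bold>\<times> C) P'" by auto
  fix j assume j: "j \<in> J"
  let ?t = "tupling A J P' p' (P \<^bold>\<times> C) (\<lambda>j. p (\<phi> j) \<bullet> \<pi>\<^sub>1 P C)"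
  have "p' j \<bullet> F' \<bullet> \<langle>?t, \<pi>\<^sub>2 P C\<rangle> =
    (f \<bullet> \<langle>tupling A Z W w (P' \<^bold>\<times> C) (\<lambda>z. p' (\<delta>' j z) \<bullet> \<pi>\<^sub>1 P' C), \<pi>\<^sub>2 P' C\<rangle>) \<bullet> \<langle>?t, \<pi>\<^sub>2 P C\<rangle>"
    using j by (intro comp_reassoc aut_systemD(9)[OF S']) auto
  also have "\<dots> = p (\<phi> j) \<bullet> F"
    using j by (simp add: aut_systemD(9)[OF S] hom)
  finally show "p (\<phi> j) \<bullet> F = p' j \<bullet> F' \<bullet> \<langle>?t, \<pi>\<^sub>2 P C\<rangle>" by simp
qed

text \<open>\<open>J\<close> is hidden in the object: the identity for \<open>I\<close>, taken at a
  \<open>J\<close>-fold power of \<open>A\<close>, merges the outer states and leaves the system of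
  \<open>J\<close>. The identity for \<open>J\<close> is not assumed, so quotients, where it is the
  goal, are covered too.\<close>

lemma aut_system_dag_product:
  assumes G: "Gamma_identity I Z \<delta>" and cl: "closed_action I Z \<delta>" and cl': "closed_action J Z \<delta>'"
    and fin: "finite I" "finite Z"
    and S: "aut_system A C (I \<times> J) Z (\<lambda>(i, j) z. (\<delta> i z, \<delta>' j z)) Q q W w f F"
    and S': "aut_system A C J Z \<delta>' P p W w f F'"
    and ij: "i \<in> I" "j \<in> J"
  shows "q (i, j) \<bullet> dag C F = p j \<bullet> dag C F'"
proof -
  obtain R r where R: "is_power P I R r" using power_exists[OF fin(1)] by blast
  obtain V v where V: "is_power P Z V v" using power_exists[OF fin(2)] by blast
  note [simp] = aut_systemD(1-8)[OF S] aut_systemD(1-8)[OF S'] closed_actionD[OF cl] closed_actionD[OF cl']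
    power_proj_simps[OF aut_systemD(1)[OF S']] power_proj_simps[OF aut_systemD(2)[OF S]]
    R V power_proj_simps[OF R] power_proj_simps[OF V]
  \<comment> \<open>State \<open>j\<close> finds in letter position \<open>z\<close> the coordinate
    \<open>\<delta>' j z\<close> of the entry \<open>z\<close>: \<open>J\<close> moves inside a
    tuple, while \<open>I\<close> will move between tuples.\<close>
  define g where "g j = f \<bullet> \<langle>tupling A Z W w (V \<^bold>\<times> C) (\<lambda>z. p (\<delta>' j z) \<bullet> v z \<bullet> \<pi>\<^sub>1 V C), \<pi>\<^sub>2 V C\<rangle>" for j
  have g [simp]: "arr (g j)" "dom (g j) = V \<^bold>\<times> C" "cod (g j) = A" if "j \<in> J" for j
    using that by (simp_all add: g_def)
  define f2 where "f2 = tupling A J P p (V \<^bold>\<times> C) g"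
  have f2 [simp]: "arr f2" "dom f2 = V \<^bold>\<times> C" "cod f2 = P" by (simp_all add: f2_def)
  have pf2: "p j \<bullet> f2 \<bullet> y = g j \<bullet> y" if "arr y" "cod y = V \<^bold>\<times> C" "j \<in> J" for j y
    using that by (intro comp_reassoc) (auto simp: f2_def)
  obtain F2 where F2: "aut_system P C I Z \<delta> R r V v f2 F2"
    using aut_system_exists[OF R V _ cl, of f2 C] by auto
  note [simp] = aut_systemD(6-8)[OF F2]
  \<comment> \<open>When all entries are equal, the motion between tuples is invisible and the
    system of \<open>J\<close> remains.\<close>
  have "f2 \<bullet> \<langle>tupling P Z V v (P \<^bold>\<times> C) (\<lambda>z. \<pi>\<^sub>1 P C), \<pi>\<^sub>2 P C\<rangle> = F'"
  proof (rule power_eqI[OF aut_systemD(1)[OF S'], of _ "P \<^bold>\<times> C"])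
    fix j assume "j \<in> J"
    then show "p j \<bullet> f2 \<bullet> \<langle>tupling P Z V v (P \<^bold>\<times> C) (\<lambda>z. \<pi>\<^sub>1 P C), \<pi>\<^sub>2 P C\<rangle> = p j \<bullet> F'"
      by (simp add: pf2 aut_systemD(9)[OF S']) (simp add: g_def)
  qed auto
  then have rF2: "r i \<bullet> dag C F2 = dag C F'"
    using Gamma_identityD[OF G F2 ij(1)] by simp
  \<comment> \<open>Read through the coordinates \<open>(i, j)\<close>, the morphism
    \<open>F2\<close> is the system of the product automaton for \<open>f\<close> itself.\<close>
  have "aut_system A C (I \<times> J) Z (\<lambda>(i, j) z. (\<delta> i z, \<delta>' j z)) R (\<lambda>(i, j). p j \<bullet> r i) W w f F2"
    unfolding aut_system_def
  proof (intro conjI ballI)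
    show "is_power A (I \<times> J) R (\<lambda>(i, j). p j \<bullet> r i)"
      by (rule power_power[OF aut_systemD(1)[OF S'] R])
    fix k assume "k \<in> I \<times> J"
    then obtain i j where k: "k = (i, j)" "i \<in> I" "j \<in> J" by auto
    then have "(p j \<bullet> r i) \<bullet> F2 = f \<bullet> \<langle>tupling A Z W w (R \<^bold>\<times> C)
        (\<lambda>z. (p (\<delta>' j z) \<bullet> r (\<delta> i z)) \<bullet> \<pi>\<^sub>1 R C), \<pi>\<^sub>2 R C\<rangle>"
      by (simp add: aut_systemD(9)[OF F2] pf2) (simp add: g_def)
    then show "(case k of (i, j) \<Rightarrow> p j \<bullet> r i) \<bullet> F2 = f \<bullet> \<langle>tupling A Z W w (R \<^bold>\<times> C)
        (\<lambda>z. (case (case k of (i, j) \<Rightarrow> \<lambda>z. (\<delta> i z, \<delta>' j z)) z of (i, j) \<Rightarrow> p j \<bullet> r i) \<bullet> \<pi>\<^sub>1 R C), \<pi>\<^sub>2 R C\<rangle>"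
      by (simp add: k(1))
  qed auto
  moreover have "closed_action (I \<times> J) Z (\<lambda>(i, j) z. (\<delta> i z, \<delta>' j z))"
    using cl cl' by (auto simp: closed_action_def)
  ultimately have "q (i, j) \<bullet> dag C F = (p j \<bullet> r i) \<bullet> dag C F2"
    using aut_system_dag_inj[OF S, of "I \<times> J" _ R _ F2 "\<lambda>k. k" "(i, j)"] ij by simp
  then show ?thesis using ij rF2 by simp
qed

section \<open>Products, subautomata, quotients, powers, and words as letters\<close>

lemma Gamma_identity_product:
  assumes G: "Gamma_identity I Z \<delta>" and G': "Gamma_identity J Z \<delta>'"
    and cl: "closed_action I Z \<delta>" "closed_action J Z \<delta>'" and fin: "finite I" "finite J" "finite Z"
  shows "Gamma_identity (I \<times> J) Z (\<lambda>(i, j) z. (\<delta> i z, \<delta>' j z))"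
proof (rule Gamma_identityI)
  fix A C Q q W w f F k
  assume S: "aut_system A C (I \<times> J) Z (\<lambda>(i, j) z. (\<delta> i z, \<delta>' j z)) Q q W w f F" and k: "k \<in> I \<times> J"
  have f: "f \<in> Hom (W \<^bold>\<times> C) A" using aut_systemD[OF S] by simp
  obtain P p where P: "is_power A J P p" using power_exists[OF fin(2)] by blast
  obtain F' where S': "aut_system A C J Z \<delta>' P p W w f F'"
    using aut_system_exists[OF P aut_systemD(2)[OF S] f cl(2)] by blast
  from k show "q k \<bullet> dag C F = dag C (f \<bullet> \<langle>tupling A Z W w (A \<^bold>\<times> C) (\<lambda>z. \<pi>\<^sub>1 A C), \<pi>\<^sub>2 A C\<rangle>)"
    using aut_system_dag_product[OF G cl fin(1,3) S S'] Gamma_identityD[OF G' S'] by auto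
qed

lemma Gamma_identity_subautomaton:
  assumes G: "Gamma_identity I Z \<delta>" and cl: "closed_action I Z \<delta>" "closed_action J Z \<delta>'" and fin: "finite I"
    and \<phi>: "inj_on \<phi> J" "\<phi> ` J \<subseteq> I"
    and hom: "\<And>j z. j \<in> J \<Longrightarrow> z \<in> Z \<Longrightarrow> \<phi> (\<delta>' j z) = \<delta> (\<phi> j) z"
  shows "Gamma_identity J Z \<delta>'"
proof (rule Gamma_identityI)
  fix A C P' p' W w f F' j
  assume S': "aut_system A C J Z \<delta>' P' p' W w f F'" and j: "j \<in> J"
  have f: "f \<in> Hom (W \<^bold>\<times> C) A" using aut_systemD[OF S'] by simp
  obtain P p where P: "is_power A I P p" using power_exists[OF fin] by blast
  obtain F where S: "aut_system A C I Z \<delta> P p W w f F"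
    using aut_system_exists[OF P aut_systemD(2)[OF S'] f cl(1)] by blast
  have \<phi>j: "\<phi> j \<in> I" using \<phi>(2) j by blast
  have "p (\<phi> j) \<bullet> dag C F = p' j \<bullet> dag C F'"
    using aut_system_dag_inj[OF S S' cl \<phi> _ j] hom by blast
  then show "p' j \<bullet> dag C F' = dag C (f \<bullet> \<langle>tupling A Z W w (A \<^bold>\<times> C) (\<lambda>z. \<pi>\<^sub>1 A C), \<pi>\<^sub>2 A C\<rangle>)"
    using Gamma_identityD[OF G S \<phi>j] by (rule trans[OF sym])
qed

lemma Gamma_identity_quotient:
  assumes G: "Gamma_identity I Z \<delta>" and cl: "closed_action I Z \<delta>" "closed_action J Z \<delta>'"
    and fin: "finite I" "finite Z" and \<psi>: "\<psi> ` I = J"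
    and hom: "\<And>i z. i \<in> I \<Longrightarrow> z \<in> Z \<Longrightarrow> \<psi> (\<delta> i z) = \<delta>' (\<psi> i) z"
  shows "Gamma_identity J Z \<delta>'"
proof (rule Gamma_identityI)
  fix A C P' p' W w f F' j
  assume S': "aut_system A C J Z \<delta>' P' p' W w f F'" and "j \<in> J"
  then obtain i where i: "i \<in> I" "j = \<psi> i" using \<psi> by auto
  have f: "f \<in> Hom (W \<^bold>\<times> C) A" using aut_systemD[OF S'] by simp
  obtain P p where P: "is_power A I P p" using power_exists[OF fin(1)] by blast
  obtain F where S: "aut_system A C I Z \<delta> P p W w f F"
    using aut_system_exists[OF P aut_systemD(2)[OF S'] f cl(1)] by blast
  let ?\<delta> = "\<lambda>(i, j) z. (\<delta> i z, \<delta>' j z)"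
  have clp: "closed_action (I \<times> J) Z ?\<delta>" using cl by (auto simp: closed_action_def)
  have "finite (I \<times> J)" using fin \<psi> by blast
  then obtain Q q where Q: "is_power A (I \<times> J) Q q" using power_exists by blast
  obtain E where E: "aut_system A C (I \<times> J) Z ?\<delta> Q q W w f E"
    using aut_system_exists[OF Q aut_systemD(2)[OF S'] f clp] by blast
  \<comment> \<open>The product system mediates: its component \<open>(i, \<psi> i)\<close> agrees
    with the quotient by the previous lemma on products, and with \<open>I\<close> because the graph
    of \<open>\<psi>\<close> is a copy of \<open>I\<close>.\<close>
  have "p' j \<bullet> dag C F' = q (i, j) \<bullet> dag C E"
    using aut_system_dag_product[OF G cl fin E S' i(1) \<open>j \<in> J\<close>] by simp
  also have "\<dots> = p i \<bullet> dag C F"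
    unfolding i(2) by (rule aut_system_dag_inj[OF E S clp cl(1), where \<phi> = "\<lambda>i. (i, \<psi> i)"])
      (use hom \<psi> i in \<open>auto simp: inj_on_def\<close>)
  finally show "p' j \<bullet> dag C F' = dag C (f \<bullet> \<langle>tupling A Z W w (A \<^bold>\<times> C) (\<lambda>z. \<pi>\<^sub>1 A C), \<pi>\<^sub>2 A C\<rangle>)"
    by (rule trans[OF _ Gamma_identityD[OF G S i(1)]])
qed

lemma closed_action_PiE:
  "closed_action I Z \<delta> \<Longrightarrow> closed_action (D \<rightarrow>\<^sub>E I) Z (\<lambda>x z. \<lambda>d\<in>D. \<delta> (x d) z)"
  by (auto simp: closed_action_def)

text \<open>Induction on \<open>D\<close>: evaluation at the only index embeds a one-fold power into
  \<open>I\<close>, and splitting off one coordinate embeds the power over \<open>insert d D\<close>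
  into the product of \<open>I\<close> with the power over \<open>D\<close>.\<close>

lemma Gamma_identity_PiE:
  assumes G: "Gamma_identity I Z \<delta>" and cl: "closed_action I Z \<delta>" and fin: "finite I" "finite Z"
    and D: "finite D" "D \<noteq> {}"
  shows "Gamma_identity (D \<rightarrow>\<^sub>E I) Z (\<lambda>x z. \<lambda>d\<in>D. \<delta> (x d) z)"
  using D
proof (induction rule: finite_ne_induct)
  case (singleton d)
  have "inj_on (\<lambda>x. x d) ({d} \<rightarrow>\<^sub>E I)"
    by (rule inj_onI, rule PiE_ext) auto
  then show ?case
    by (rule Gamma_identity_subautomaton[OF G cl closed_action_PiE[OF cl] fin(1)]) auto
next
  case (insert d D)
  have clp: "closed_action (I \<times> (D \<rightarrow>\<^sub>E I)) Z (\<lambda>(i, x) z. (\<delta> i z, \<lambda>d\<in>D. \<delta> (x d) z))"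
    using cl by (auto simp: closed_action_def)
  have finD: "finite (D \<rightarrow>\<^sub>E I)" using fin(1) insert.hyps(1) by (auto intro!: finite_PiE)
  have prod: "Gamma_identity (I \<times> (D \<rightarrow>\<^sub>E I)) Z (\<lambda>(i, x) z. (\<delta> i z, \<lambda>d\<in>D. \<delta> (x d) z))"
    by (rule Gamma_identity_product[OF G insert.IH cl closed_action_PiE[OF cl] fin(1) finD fin(2)])
  have "inj_on (\<lambda>x. (x d, restrict x D)) (insert d D \<rightarrow>\<^sub>E I)"
  proof (rule inj_onI)
    fix x y assume x: "x \<in> insert d D \<rightarrow>\<^sub>E I" and y: "y \<in> insert d D \<rightarrow>\<^sub>E I"
      and eq: "(x d, restrict x D) = (y d, restrict y D)"
    show "x = y"
    proof (rule PiE_ext[OF x y])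
      fix k assume "k \<in> insert d D"
      then show "x k = y k" using eq by (auto dest: fun_cong[of _ _ k])
    qed
  qed
  then show ?case
    by (rule Gamma_identity_subautomaton[OF prod clp closed_action_PiE[OF cl] finite_cartesian_product[OF fin(1) finD]])
      (auto simp: restrict_def)
qed

lemma Gamma_identity_words:
  fixes word :: "'l \<Rightarrow> 'z list"
  assumes G: "Gamma_identity I Z \<delta>" and cl: "closed_action I Z \<delta>" and fin: "finite I" "finite Z" "finite L"
    and word: "\<And>l. l \<in> L \<Longrightarrow> word l \<noteq> []" "\<And>l. l \<in> L \<Longrightarrow> set (word l) \<subseteq> Z"
  shows "Gamma_identity I L (\<lambda>i l. foldl \<delta> i (word l))"
proof (rule Gamma_identityI)
  fix A C P p W w f F i
  assume S: "aut_system A C I L (\<lambda>i l. foldl \<delta> i (word l)) P p W w f F" and i: "i \<in> I"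
  \<comment> \<open>A crude bound for the lengths of all words: \<open>U\<close> then contains
    \<open>[]\<close> and the tail of each \<open>word l\<close>, and is closed under tails.\<close>
  define N where "N = (\<Sum>l\<in>L. length (word l))"
  define U where "U = {u. set u \<subseteq> Z \<and> length u \<le> N}"
  have "finite U" unfolding U_def by (rule finite_lists_length_le[OF fin(2)])
  then obtain B s where B: "is_power A U B s" using power_exists by blast
  obtain R r where R: "is_power B I R r" using power_exists[OF fin(1)] by blast
  obtain V v where V: "is_power B Z V v" using power_exists[OF fin(2)] by blast
  have P: "is_power A I P p" and W: "is_power A L W w" using aut_systemD(1,2)[OF S] .
  have Nil_U [simp]: "[] \<in> U" by (simp add: U_def)
  have hd_Z [simp]: "hd (word l) \<in> Z" and tl_U [simp]: "tl (word l) \<in> U" if l: "l \<in> L" for l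
  proof -
    have "length (word l) \<le> N" unfolding N_def using l fin(3) by (intro member_le_sum) auto
    then show "hd (word l) \<in> Z" "tl (word l) \<in> U"
      using word[OF l] by (cases "word l"; auto simp: U_def)+
  qed
  have Cons_U: "a \<in> Z" "u \<in> U" if "a # u \<in> U" for a u using that by (auto simp: U_def)
  have foldl_I [simp]: "foldl \<delta> i u \<in> I" if "i \<in> I" "u \<in> U" for i u
  proof -
    have "foldl \<delta> i u \<in> I" if "i \<in> I" "set u \<subseteq> Z"
      using that by (induction u arbitrary: i) (auto simp: closed_actionD[OF cl])
    then show ?thesis using that by (simp add: U_def)
  qed
  have foldl_word: "foldl \<delta> i (word l) = foldl \<delta> (\<delta> i (hd (word l))) (tl (word l))" if "l \<in> L" for i l
    using word(1)[OF that] by (cases "word l") auto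
  note [simp] = aut_systemD(1-8)[OF S] closed_actionD[OF cl] B R V
    power_proj_simps[OF P] power_proj_simps[OF W] power_proj_simps[OF B]
    power_proj_simps[OF R] power_proj_simps[OF V]

  \<comment> \<open>The argument of \<open>f\<close> at letter \<open>l\<close>: the first letter of
    the word is a genuine step of the automaton, the rest is left to the coordinate
    \<open>tl (word l)\<close> of the state reached. Here the words must be nonempty.\<close>
  define t where "t = tupling A L W w V (\<lambda>l. s (tl (word l)) \<bullet> v (hd (word l)))"
  have t [simp]: "arr t" "dom t = V" "cod t = W" by (simp_all add: t_def)
  \<comment> \<open>Coordinate \<open>[]\<close> carries the original equation. Coordinate
    \<open>a # u'\<close> of a state is an alias of coordinate \<open>u'\<close> of its successor
    under \<open>a\<close>.\<close>
  define g where "g u = (case u of [] \<Rightarrow> f \<bullet> \<langle>t \<bullet> \<pi>\<^sub>1 V C, \<pi>\<^sub>2 V C\<rangle> | a # u' \<Rightarrow> s u' \<bullet> v a \<bullet> \<pi>\<^sub>1 V C)" for u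
  have g [simp]: "arr (g u)" "dom (g u) = V \<^bold>\<times> C" "cod (g u) = A" if "u \<in> U" for u
    using that by (cases u; simp add: g_def Cons_U)+
  define f2 where "f2 = tupling A U B s (V \<^bold>\<times> C) g"
  have f2 [simp]: "arr f2" "dom f2 = V \<^bold>\<times> C" "cod f2 = B" by (simp_all add: f2_def)
  have sf2: "s u \<bullet> f2 \<bullet> y = g u \<bullet> y" if "arr y" "cod y = V \<^bold>\<times> C" "u \<in> U" for u y
    using that by (intro comp_reassoc) (auto simp: f2_def)
  obtain F2 where F2: "aut_system B C I Z \<delta> R r V v f2 F2"
    using aut_system_exists[OF R V _ cl, of f2 C] by auto
  note [simp] = aut_systemD(6-8)[OF F2]
  \<comment> \<open>What remains of \<open>F2\<close> once all states are identified: a system in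
    unknowns indexed by \<open>U\<close>.\<close>
  define E where "E = f2 \<bullet> \<langle>tupling B Z V v (B \<^bold>\<times> C) (\<lambda>z. \<pi>\<^sub>1 B C), \<pi>\<^sub>2 B C\<rangle>"
  have E [simp]: "arr E" "dom E = B \<^bold>\<times> C" "cod E = B" by (simp_all add: E_def)
  have rF2: "r i \<bullet> dag C F2 = dag C E" unfolding E_def by (rule Gamma_identityD[OF G F2 i])

  \<comment> \<open>Without states an alias merely shortens the word, so all unknowns of
    \<open>E\<close> reduce to that of \<open>[]\<close> and the diagonal recovers them.\<close>
  define \<sigma> where "\<sigma> = tupling A U B s A (\<lambda>_. ident A)"
  have \<sigma> [simp]: "arr \<sigma>" "dom \<sigma> = A" "cod \<sigma> = B" by (simp_all add: \<sigma>_def)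
  have s\<sigma>: "s u \<bullet> \<sigma> = ident A" if "u \<in> U" for u using that by (simp add: \<sigma>_def)
  have s\<sigma>': "s u \<bullet> \<sigma> \<bullet> y = y" if "u \<in> U" "arr y" "cod y = A" for u y
    using comp_reassoc[OF s\<sigma>, of u y] that by simp
  have "dag C E = \<sigma> \<bullet> dag C ((s [] \<bullet> E) \<bullet> \<langle>\<sigma> \<bullet> \<pi>\<^sub>1 A C, \<pi>\<^sub>2 A C\<rangle>)"
  proof (rule dag_eliminate[OF B, where core = "\<lambda>u. u = []" and nxt = tl and rank = length])
    fix u assume u: "u \<in> U" "u \<noteq> []"
    then obtain a u' where u': "u = a # u'" by (cases u) auto
    with u Cons_U[of a u'] show "tl u \<in> U" "s u \<bullet> E = s (tl u) \<bullet> \<pi>\<^sub>1 B C" "s u \<bullet> \<sigma> = s (tl u) \<bullet> \<sigma>"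
      by (simp_all add: E_def sf2 s\<sigma>) (simp add: g_def)
  qed (auto simp: s\<sigma>')
  also have "(s [] \<bullet> E) \<bullet> \<langle>\<sigma> \<bullet> \<pi>\<^sub>1 A C, \<pi>\<^sub>2 A C\<rangle> =
      f \<bullet> \<langle>tupling A L W w (A \<^bold>\<times> C) (\<lambda>z. \<pi>\<^sub>1 A C), \<pi>\<^sub>2 A C\<rangle>"
    by (simp add: E_def sf2) (simp add: g_def t_def s\<sigma>')
  finally have sE: "s [] \<bullet> dag C E =
      dag C (f \<bullet> \<langle>tupling A L W w (A \<^bold>\<times> C) (\<lambda>z. \<pi>\<^sub>1 A C), \<pi>\<^sub>2 A C\<rangle>)"
    by (simp add: s\<sigma>')

  \<comment> \<open>For \<open>F2\<close> itself the elimination keeps the unknowns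
    \<open>(i, [])\<close>: \<open>\<tau>\<close> gives the unknown \<open>(i, u)\<close> the value
    at the state reached from \<open>i\<close> by \<open>u\<close>.\<close>
  define \<tau> where "\<tau> = tupling B I R r P (\<lambda>i. tupling A U B s P (\<lambda>u. p (foldl \<delta> i u)))"
  have \<tau> [simp]: "arr \<tau>" "dom \<tau> = P" "cod \<tau> = R" by (simp_all add: \<tau>_def)
  have r\<tau>: "s u \<bullet> r i \<bullet> \<tau> = p (foldl \<delta> i u)" if "i \<in> I" "u \<in> U" for i u
    using that by (simp add: \<tau>_def)
  have r\<tau>': "s u \<bullet> r i \<bullet> \<tau> \<bullet> y = p (foldl \<delta> i u) \<bullet> y"
    if "i \<in> I" "u \<in> U" "arr y" "cod y = P" for i u y
    using comp_reassoc[of "s u \<bullet> r i" \<tau> "p (foldl \<delta> i u)" y] that by (simp add: r\<tau>)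
  define \<psi> where "\<psi> = tupling A I P p (R \<^bold>\<times> C) (\<lambda>i. s [] \<bullet> r i \<bullet> F2)"
  have \<psi> [simp]: "arr \<psi>" "dom \<psi> = R \<^bold>\<times> C" "cod \<psi> = P" by (simp_all add: \<psi>_def)
  have p\<psi>: "p i \<bullet> \<psi> = s [] \<bullet> r i \<bullet> F2" if "i \<in> I" for i
    using that by (simp add: \<psi>_def)
  have rF2': "r i \<bullet> F2 \<bullet> y = (f2 \<bullet> \<langle>tupling B Z V v (R \<^bold>\<times> C) (\<lambda>z. r (\<delta> i z) \<bullet> \<pi>\<^sub>1 R C), \<pi>\<^sub>2 R C\<rangle>) \<bullet> y"
    if "i \<in> I" "arr y" "cod y = R \<^bold>\<times> C" for i y
    using that by (intro comp_reassoc aut_systemD(9)[OF F2]) auto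
  have "dag C F2 = \<tau> \<bullet> dag C (\<psi> \<bullet> \<langle>\<tau> \<bullet> \<pi>\<^sub>1 P C, \<pi>\<^sub>2 P C\<rangle>)"
  proof (rule dag_eliminate[OF power_power[OF B R], where core = "\<lambda>(i, u). u = []"
        and nxt = "\<lambda>(i, u). (\<delta> i (hd u), tl u)" and rank = "\<lambda>(i, u). length u"])
    fix k assume "k \<in> I \<times> U" and nc: "\<not> (case k of (i, u) \<Rightarrow> u = [])"
    then obtain i a u where k: "k = (i, a # u)" "i \<in> I" "a # u \<in> U" by (cases k; cases "snd k") auto
    with Cons_U[of a u] have au: "a \<in> Z" "u \<in> U" by auto
    from k au show "(case k of (i, u) \<Rightarrow> (\<delta> i (hd u), tl u)) \<in> I \<times> U" by simp
    from k show "(case (case k of (i, u) \<Rightarrow> (\<delta> i (hd u), tl u)) of (i, u) \<Rightarrow> length u) <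
      (case k of (i, u) \<Rightarrow> length u)" by simp
    from k au show "(case k of (i, u) \<Rightarrow> s u \<bullet> r i) \<bullet> F2 =
      (case (case k of (i, u) \<Rightarrow> (\<delta> i (hd u), tl u)) of (i, u) \<Rightarrow> s u \<bullet> r i) \<bullet> \<pi>\<^sub>1 R C"
      by (simp add: aut_systemD(9)[OF F2] sf2) (simp add: g_def)
    from k au show "(case k of (i, u) \<Rightarrow> s u \<bullet> r i) \<bullet> \<tau> =
      (case (case k of (i, u) \<Rightarrow> (\<delta> i (hd u), tl u)) of (i, u) \<Rightarrow> s u \<bullet> r i) \<bullet> \<tau>"
      by (simp add: r\<tau>)
  next
    fix k assume "k \<in> I \<times> U" and "case k of (i, u) \<Rightarrow> u = []"
    then obtain i where k: "k = (i, [])" "i \<in> I" by auto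
    then show "(case k of (i, u) \<Rightarrow> s u \<bullet> r i) \<bullet> F2 = (case k of (i, u) \<Rightarrow> s u \<bullet> r i) \<bullet> \<tau> \<bullet> \<psi>"
      by (simp add: r\<tau>' p\<psi>)
  qed auto
  \<comment> \<open>After the elimination, letter \<open>l\<close> at state \<open>i\<close> reads
    the state reached by the whole of \<open>word l\<close>, as the new action demands.\<close>
  also have "\<psi> \<bullet> \<langle>\<tau> \<bullet> \<pi>\<^sub>1 P C, \<pi>\<^sub>2 P C\<rangle> = F"
  proof (rule power_eqI[OF P, of _ "P \<^bold>\<times> C"])
    fix i assume i: "i \<in> I"
    then have "p i \<bullet> \<psi> \<bullet> \<langle>\<tau> \<bullet> \<pi>\<^sub>1 P C, \<pi>\<^sub>2 P C\<rangle> = s [] \<bullet> r i \<bullet> F2 \<bullet> \<langle>\<tau> \<bullet> \<pi>\<^sub>1 P C, \<pi>\<^sub>2 P C\<rangle>"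
      using comp_reassoc[OF p\<psi>, of i "\<langle>\<tau> \<bullet> \<pi>\<^sub>1 P C, \<pi>\<^sub>2 P C\<rangle>"] by simp
    also have "\<dots> = p i \<bullet> F"
      using i by (simp add: rF2' sf2 aut_systemD(9)[OF S]) (simp add: g_def t_def r\<tau>' foldl_word)
    finally show "p i \<bullet> \<psi> \<bullet> \<langle>\<tau> \<bullet> \<pi>\<^sub>1 P C, \<pi>\<^sub>2 P C\<rangle> = p i \<bullet> F" .
  qed auto
  finally have "p i \<bullet> dag C F = s [] \<bullet> r i \<bullet> dag C F2" using i by (simp add: r\<tau>')
  then show "p i \<bullet> dag C F = dag C (f \<bullet> \<langle>tupling A L W w (A \<^bold>\<times> C) (\<lambda>z. \<pi>\<^sub>1 A C), \<pi>\<^sub>2 A C\<rangle>)"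
    using rF2 sE by simp
qed

section \<open>Comparison with the chosen powers\<close>

lemma diag_eq_tupling:
  assumes "n \<ge> 1"
  shows "cc_diag K A n = tupling A {0..<n} (cc_pow K A n) (cc_proj K A n) A (\<lambda>_. ident A)"
  unfolding cc_diag_def using assms by (intro tupN_eq_tupling) auto

text \<open>The nested tuples in \<open>cc_rho\<close> and \<open>cc_fQ\<close> are tuplings for the
  chosen powers, so their components can be read off.\<close>

lemma aut_system_fQ:
  assumes nm: "n \<ge> 1" "m \<ge> 1" and cl: "closed_action {0..<n} {0..<m} \<delta>"
    and f: "f \<in> Hom (cc_pow K A m \<^bold>\<times> C) A"
  shows "aut_system A C {0..<n} {0..<m} \<delta> (cc_pow K A n) (cc_proj K A n)
    (cc_pow K A m) (cc_proj K A m) f (cc_fQ K A C n m \<delta> f)"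
proof -
  define I where "I = {0..<n}"
  define Z where "Z = {0..<m}"
  define P where "P = cc_pow K A n"
  define p where "p = cc_proj K A n"
  define W where "W = cc_pow K A m"
  define w where "w = cc_proj K A m"
  note defs = I_def Z_def P_def p_def W_def w_def
  have P: "is_power A I P p" and W: "is_power A Z W w"
    unfolding defs using power_pow nm by auto
  have cl: "closed_action I Z \<delta>" using cl by (simp only: defs)
  note [simp] = P W power_proj_simps[OF P] power_proj_simps[OF W] closed_actionD[OF cl]
  have f: "arr f" "dom f = W \<^bold>\<times> C" "cod f = A" using f by (auto simp: W_def)
  note [simp] = f
  have rho: "cc_rho K A n m \<delta> i = tupling A Z W w P (\<lambda>z. p (\<delta> i z))" if i: "i \<in> I" for i
    unfolding cc_rho_def defs
  proof (rule tupN_eq_tupling[OF nm(2)])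
    fix z assume "z < m"
    then have "z \<in> Z" by (simp add: Z_def)
    with i have "p (\<delta> i z) \<in> Hom P A" by simp
    then show "cc_proj K A n (\<delta> i z) \<in> Hom (cc_pow K A n) A" by (simp only: defs)
  qed
  define g where "g i = f \<bullet> cc_cross K (cc_rho K A n m \<delta> i) (ident C)" for i
  have g: "g i = f \<bullet> \<langle>tupling A Z W w (P \<^bold>\<times> C) (\<lambda>z. p (\<delta> i z) \<bullet> \<pi>\<^sub>1 P C), \<pi>\<^sub>2 P C\<rangle>" if "i \<in> I" for i
    using that by (simp add: g_def cross_eq rho)
  have "cc_fQ K A C n m \<delta> f = tupling A I P p (P \<^bold>\<times> C) g"
    unfolding cc_fQ_def g_def[symmetric] unfolding I_def P_def p_def
  proof (rule tupN_eq_tupling[OF nm(1)])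
    fix i assume "i < n"
    then have "i \<in> I" by (simp add: I_def)
    then have "g i \<in> Hom (P \<^bold>\<times> C) A" by (simp add: g)
    then show "g i \<in> Hom (cc_pow K A n \<^bold>\<times> C) A" by (simp only: defs)
  qed
  then have "aut_system A C I Z \<delta> P p W w f (cc_fQ K A C n m \<delta> f)"
    unfolding aut_system_def by (simp add: g)
  then show ?thesis by (simp only: defs)
qed

lemma Gamma_identity_if_satisfies_Gamma:
  assumes aut: "fin_automaton n m \<delta>" and sat: "satisfies_Gamma K n m \<delta>"
  shows "Gamma_identity {0..<n} {0..<m} \<delta>"
proof -
  have nm: "n \<ge> 1" "m \<ge> 1" and cl: "closed_action {0..<n} {0..<m} \<delta>"
    using aut by (auto simp: fin_automaton_def closed_action_def)
  define I where "I = {0..<n}"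
  define Z where "Z = {0..<m}"
  have cl': "closed_action I Z \<delta>" using cl by (simp only: I_def Z_def)
  have "Gamma_identity I Z \<delta>"
  proof (rule Gamma_identityI)
    fix A C P p W w f F i
    assume S: "aut_system A C I Z \<delta> P p W w f F" and i: "i \<in> I"
    define Q where "Q = cc_pow K A n"
    define q where "q = cc_proj K A n"
    define V where "V = cc_pow K A m"
    define v where "v = cc_proj K A m"
    note defs = Q_def q_def V_def v_def I_def Z_def
    have Q: "is_power A I Q q" and V: "is_power A Z V v"
      unfolding defs using power_pow nm by auto
    have W: "is_power A Z W w" using aut_systemD(2)[OF S] .
    note [simp] = aut_systemD(1-8)[OF S] closed_actionD[OF cl'] Q V
      power_proj_simps[OF Q] power_proj_simps[OF V] power_proj_simps[OF W]
    \<comment> \<open>The comparison of the chosen power \<open>V\<close> with \<open>W\<close>;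
      transporting \<open>f\<close> along it yields a morphism to which the assumed identity
      applies.\<close>
    define \<theta> where "\<theta> = tupling A Z W w V v"
    have [simp]: "arr \<theta>" "dom \<theta> = V" "cod \<theta> = W" by (simp_all add: \<theta>_def)
    define f0 where "f0 = f \<bullet> \<langle>\<theta> \<bullet> \<pi>\<^sub>1 V C, \<pi>\<^sub>2 V C\<rangle>"
    have f0 [simp]: "arr f0" "dom f0 = V \<^bold>\<times> C" "cod f0 = A" by (simp_all add: f0_def)
    define F0 where "F0 = cc_fQ K A C n m \<delta> f0"
    have f0': "f0 \<in> Hom (cc_pow K A m \<^bold>\<times> C) A" by (simp add: V_def[symmetric])
    note S0 = aut_system_fQ[OF nm cl f0', folded defs, folded F0_def]
    note [simp] = aut_systemD(6-8)[OF S0]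
    \<comment> \<open>As \<open>\<theta>\<close> commutes with the projections, \<open>F0\<close> is
      also a system for \<open>f\<close>; the change from \<open>P\<close> to the chosen power is
      then reindexing along the identity.\<close>
    have "aut_system A C I Z \<delta> Q q W w f F0"
      unfolding aut_system_def by (simp add: aut_systemD(9)[OF S0]) (simp add: f0_def \<theta>_def)
    then have "p i \<bullet> dag C F = q i \<bullet> dag C F0"
      using aut_system_dag_inj[OF S _ cl' cl', of Q q F0 "\<lambda>i. i" i] i by simp
    also have "dag C F0 = cc_diag K A n \<bullet> dag C (f0 \<bullet> cc_cross K (cc_diag K A m) (ident C))"
      using sat f0' unfolding satisfies_Gamma_def F0_def by blast
    also have "cc_diag K A n = tupling A I Q q A (\<lambda>_. ident A)"
      unfolding defs by (rule diag_eq_tupling[OF nm(1)])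
    also have "cc_diag K A m = tupling A Z V v A (\<lambda>_. ident A)"
      unfolding defs by (rule diag_eq_tupling[OF nm(2)])
    also have "f0 \<bullet> cc_cross K (tupling A Z V v A (\<lambda>_. ident A)) (ident C) =
        f \<bullet> \<langle>tupling A Z W w (A \<^bold>\<times> C) (\<lambda>z. \<pi>\<^sub>1 A C), \<pi>\<^sub>2 A C\<rangle>"
      by (simp add: cross_eq f0_def \<theta>_def)
    also have "q i \<bullet> tupling A I Q q A (\<lambda>_. ident A) \<bullet>
        dag C (f \<bullet> \<langle>tupling A Z W w (A \<^bold>\<times> C) (\<lambda>z. \<pi>\<^sub>1 A C), \<pi>\<^sub>2 A C\<rangle>) =
        dag C (f \<bullet> \<langle>tupling A Z W w (A \<^bold>\<times> C) (\<lambda>z. \<pi>\<^sub>1 A C), \<pi>\<^sub>2 A C\<rangle>)"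
      using i by simp
    finally show "p i \<bullet> dag C F =
      dag C (f \<bullet> \<langle>tupling A Z W w (A \<^bold>\<times> C) (\<lambda>z. \<pi>\<^sub>1 A C), \<pi>\<^sub>2 A C\<rangle>)" .
  qed
  then show ?thesis by (simp only: I_def Z_def)
qed

lemma satisfies_Gamma_if_Gam:
  assumes nm: "n \<ge> 1" "m \<ge> 1" and cl: "closed_action {0..<n} {0..<m} \<delta>"
    and G: "Gamma_identity {0..<n} {0..<m} \<delta>"
  shows "satisfies_Gamma K n m \<delta>"
  unfolding satisfies_Gamma_def
proof (intro allI impI)
  fix A C f assume f: "f \<in> Hom (cc_pow K A m \<^bold>\<times> C) A"
  define I where "I = {0..<n}"
  define Z where "Z = {0..<m}"
  define Q where "Q = cc_pow K A n"
  define q where "q = cc_proj K A n"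
  define V where "V = cc_pow K A m"
  define v where "v = cc_proj K A m"
  note defs = Q_def q_def V_def v_def I_def Z_def
  have Q: "is_power A I Q q" and V: "is_power A Z V v"
    unfolding defs using power_pow nm by auto
  note S = aut_system_fQ[OF nm cl f, folded defs]
  note [simp] = Q V power_proj_simps[OF Q] power_proj_simps[OF V] aut_systemD(3-8)[OF S]
  have dn: "cc_diag K A n = tupling A I Q q A (\<lambda>_. ident A)"
    unfolding defs by (rule diag_eq_tupling[OF nm(1)])
  have dm: "cc_diag K A m = tupling A Z V v A (\<lambda>_. ident A)"
    unfolding defs by (rule diag_eq_tupling[OF nm(2)])
  have eq: "f \<bullet> cc_cross K (cc_diag K A m) (ident C) =
      f \<bullet> \<langle>tupling A Z V v (A \<^bold>\<times> C) (\<lambda>z. \<pi>\<^sub>1 A C), \<pi>\<^sub>2 A C\<rangle>"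
    by (simp add: cross_eq dm)
  show "dag C (cc_fQ K A C n m \<delta> f) =
    cc_diag K A n \<bullet> dag C (f \<bullet> cc_cross K (cc_diag K A m) (ident C))"
    unfolding eq dn
  proof (rule power_eqI[OF Q, of _ C])
    fix i assume i: "i \<in> I"
    show "q i \<bullet> dag C (cc_fQ K A C n m \<delta> f) = q i \<bullet> tupling A I Q q A (\<lambda>_. ident A) \<bullet>
        dag C (f \<bullet> \<langle>tupling A Z V v (A \<^bold>\<times> C) (\<lambda>z. \<pi>\<^sub>1 A C), \<pi>\<^sub>2 A C\<rangle>)"
      using Gamma_identityD[OF G[folded I_def Z_def] S i] i by simp
  qed auto
qed

end

section \<open>Groups in the transition monoid\<close>

lemma foldl_action_closed:
  assumes "\<forall>i<n. \<forall>j<m. \<delta> i j < (n::nat)" "set u \<subseteq> {0..<m}" "i < n"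
  shows "foldl \<delta> i u < n"
  using assms(2,3) by (induction u arbitrary: i) (auto simp: assms(1))

lemma trans_monoid_mult:
  assumes "\<forall>i<n. \<forall>j<m. \<delta> i j < n" "set u \<subseteq> {0..<m}"
  shows "(\<lambda>q\<in>{0..<n}. foldl \<delta> q u) \<otimes>\<^bsub>trans_monoid n m \<delta>\<^esub> (\<lambda>q\<in>{0..<n}. foldl \<delta> q u') =
    (\<lambda>q\<in>{0..<n}. foldl \<delta> q (u @ u'))"
  using foldl_action_closed[OF assms] by (auto simp: trans_monoid_def)

text \<open>Only the identity can need the empty word, and it is \<open>y \<cdot> y\<^sup>-\<^sup>1\<close> for any other element \<open>y\<close>.\<close>

lemma nontrivial_group_nonempty_words:
  fixes \<delta> :: "nat \<Rightarrow> nat \<Rightarrow> nat"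
  assumes \<delta>: "\<forall>i<n. \<forall>j<m. \<delta> i j < n" and H: "H \<subseteq> carrier (trans_monoid n m \<delta>)"
    and grp: "group (\<lparr>carrier = H, monoid.mult = monoid.mult (trans_monoid n m \<delta>), one = e\<rparr> :: (nat \<Rightarrow> nat) monoid)"
    and nontriv: "y \<in> H" "y \<noteq> e" and x: "x \<in> H"
  shows "\<exists>u. u \<noteq> [] \<and> set u \<subseteq> {0..<m} \<and> x = (\<lambda>q\<in>{0..<n}. foldl \<delta> q u)"
proof -
  let ?M = "trans_monoid n m \<delta>"
  let ?H = "\<lparr>carrier = H, monoid.mult = monoid.mult ?M, one = e\<rparr> :: (nat \<Rightarrow> nat) monoid"
  interpret group ?H by (rule grp)
  have word: "\<exists>u. set u \<subseteq> {0..<m} \<and> z = (\<lambda>q\<in>{0..<n}. foldl \<delta> q u)" if "z \<in> H" for z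
    using H that by (auto simp: trans_monoid_def)
  \<comment> \<open>The empty word induces an idempotent, and the only idempotent of a group is its
    unit.\<close>
  have empty: "z = e" if "z \<in> H" "z = (\<lambda>q\<in>{0..<n}. foldl \<delta> q [])" for z
  proof -
    have "z \<otimes>\<^bsub>?M\<^esub> z = z" using trans_monoid_mult[OF \<delta>, of "[]" "[]"] that(2) by simp
    then show ?thesis using that(1) r_cancel_one[of z z] by simp
  qed
  obtain u where u: "set u \<subseteq> {0..<m}" "x = (\<lambda>q\<in>{0..<n}. foldl \<delta> q u)" using word[OF x] by blast
  show ?thesis
  proof (cases "u = []")
    case True
    then have "x = e" using empty[OF x] u by blast
    obtain a where a: "set a \<subseteq> {0..<m}" "y = (\<lambda>q\<in>{0..<n}. foldl \<delta> q a)"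
      using word[OF nontriv(1)] by blast
    have "a \<noteq> []" using a nontriv empty by blast
    have inv: "inv\<^bsub>?H\<^esub> y \<in> H" using inv_closed[of y] nontriv(1) by simp
    then obtain b where b: "set b \<subseteq> {0..<m}" "inv\<^bsub>?H\<^esub> y = (\<lambda>q\<in>{0..<n}. foldl \<delta> q b)"
      using word by blast
    have "y \<otimes>\<^bsub>?M\<^esub> inv\<^bsub>?H\<^esub> y = e" using r_inv[of y] nontriv(1) by simp
    then have "e = (\<lambda>q\<in>{0..<n}. foldl \<delta> q (a @ b))"
      using trans_monoid_mult[OF \<delta> a(1), of b] a(2) b(2) by simp
    with \<open>a \<noteq> []\<close> a(1) b(1) \<open>x = e\<close> show ?thesis by (intro exI[of _ "a @ b"]) auto
  qed (use u in blast)
qed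

section \<open>From the automaton to the group\<close>

theorem theorem3p2:
  fixes K :: "('o, 'm) cartcat"
    and n m :: nat and \<delta> :: "nat \<Rightarrow> nat \<Rightarrow> nat"
    and G :: "'g monoid"
  assumes "is_conway K"
    and "fin_automaton n m \<delta>"
    and "satisfies_Gamma K n m \<delta>"
    and "simple_group G" and "finite (carrier G)"
    and "group_divides G (trans_monoid n m \<delta>)"
  shows "\<forall>e. bij_betw e {0..<card (carrier G)} (carrier G) \<longrightarrow>
           satisfies_Gamma K (card (carrier G)) (card (carrier G)) (group_automaton G e)"
proof (intro allI impI)
  fix e assume e: "bij_betw e {0..<card (carrier G)} (carrier G)"
  interpret conway K by standard (rule assms(1))
  interpret G: simple_group G by (rule assms(4))
  let ?M = "trans_monoid n m \<delta>"
  define N where "N = card (carrier G)"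
  have N: "N > 1" using G.order_gt_one by (simp add: N_def order_def)
  have e: "bij_betw e {0..<N} (carrier G)" using e by (simp add: N_def)
  define idx where "idx = the_inv_into {0..<N} e"
  have idx: "idx g < N" "e (idx g) = g" if "g \<in> carrier G" for g
    using that e f_the_inv_into_f_bij_betw[OF e] bij_betw_the_inv_into[OF e]
    by (auto simp: idx_def bij_betw_def)
  have idx_e: "idx (e j) = j" and e_G: "e j \<in> carrier G" if "j < N" for j
    using that e by (auto simp: idx_def bij_betw_def the_inv_into_f_f)

  obtain H u h where H: "H \<subseteq> carrier ?M"
    and grp: "group (\<lparr>carrier = H, monoid.mult = monoid.mult ?M, one = u\<rparr> :: (nat \<Rightarrow> nat) monoid)"
    and h: "h \<in> hom (\<lparr>carrier = H, monoid.mult = monoid.mult ?M, one = u\<rparr> :: (nat \<Rightarrow> nat) monoid) G"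
    and surj: "h ` H = carrier G"
    using assms(6) unfolding group_divides_def by blast
  interpret H: group "\<lparr>carrier = H, monoid.mult = monoid.mult ?M, one = u\<rparr> :: (nat \<Rightarrow> nat) monoid"
    by (rule grp)
  have h_mult: "h (x \<otimes>\<^bsub>?M\<^esub> y) = h x \<otimes>\<^bsub>G\<^esub> h y" if "x \<in> H" "y \<in> H" for x y
    using h that by (auto simp: hom_def)
  have H_mult: "x \<otimes>\<^bsub>?M\<^esub> y \<in> H" if "x \<in> H" "y \<in> H" for x y
    using H.m_closed[of x y] that by simp
  \<comment> \<open>A simple group has more than one element, hence so does \<open>H\<close>, which
    maps onto it.\<close>
  obtain y where y: "y \<in> H" "y \<noteq> u"
  proof (rule ccontr)
    assume "\<not> thesis"
    then have "H \<subseteq> {u}" using that by blast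
    then have "carrier G \<subseteq> {h u}" using surj by blast
    then have "N \<le> 1" unfolding N_def using card_mono[of "{h u}" "carrier G"] by simp
    with N show False by simp
  qed

  have nm: "n \<ge> 1" "m \<ge> 1" and \<delta>: "\<forall>i<n. \<forall>j<m. \<delta> i j < n"
    using assms(2) by (auto simp: fin_automaton_def)
  \<comment> \<open>Letter \<open>j\<close> stands for the group element \<open>e j\<close>: a
    preimage in \<open>H\<close> is taken together with a nonempty word inducing it.\<close>
  have "\<exists>w. w \<noteq> [] \<and> set w \<subseteq> {0..<m} \<and> (\<lambda>q\<in>{0..<n}. foldl \<delta> q w) \<in> H \<and>
      h (\<lambda>q\<in>{0..<n}. foldl \<delta> q w) = e j" if j: "j < N" for j
  proof -
    obtain x where "x \<in> H" "h x = e j" using surj e_G[OF j] by (metis imageE)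
    then show ?thesis using nontrivial_group_nonempty_words[OF \<delta> H grp y] by blast
  qed
  then obtain word where word: "\<And>j. j < N \<Longrightarrow> word j \<noteq> []" "\<And>j. j < N \<Longrightarrow> set (word j) \<subseteq> {0..<m}"
    "\<And>j. j < N \<Longrightarrow> (\<lambda>q\<in>{0..<n}. foldl \<delta> q (word j)) \<in> H"
    "\<And>j. j < N \<Longrightarrow> h (\<lambda>q\<in>{0..<n}. foldl \<delta> q (word j)) = e j"
    by metis

  let ?\<delta>1 = "\<lambda>q j. foldl \<delta> q (word j)"
  have cl0: "closed_action {0..<n} {0..<m} \<delta>" using \<delta> by (auto simp: closed_action_def)
  have cl1: "closed_action {0..<n} {0..<N} ?\<delta>1"
    using foldl_action_closed[OF \<delta>] word(2) by (auto simp: closed_action_def)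
  have G1: "Gamma_identity {0..<n} {0..<N} ?\<delta>1"
    by (rule Gamma_identity_words[OF Gamma_identity_if_satisfies_Gamma[OF assms(2,3)] cl0]) (use word in auto)

  \<comment> \<open>A transition function is a tuple of \<open>n\<close> states, one for each
    starting state, so \<open>H\<close> lies inside the \<open>n\<close>-fold power.\<close>
  let ?\<delta>2 = "\<lambda>x j. \<lambda>d\<in>{0..<n}. ?\<delta>1 (x d) j"
  let ?X = "{0..<n} \<rightarrow>\<^sub>E {0..<n}"
  have G2: "Gamma_identity ?X {0..<N} ?\<delta>2"
    by (rule Gamma_identity_PiE[OF G1 cl1]) (use nm in auto)
  have cl2: "closed_action ?X {0..<N} ?\<delta>2"
    by (rule closed_action_PiE[OF cl1])
  have H_X: "H \<subseteq> ?X"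
    using H foldl_action_closed[OF \<delta>] by (auto simp: trans_monoid_def)

  let ?\<delta>3 = "\<lambda>x j. x \<otimes>\<^bsub>?M\<^esub> (\<lambda>q\<in>{0..<n}. foldl \<delta> q (word j))"
  have cl3: "closed_action H {0..<N} ?\<delta>3" using H_mult word(3) by (auto simp: closed_action_def)
  \<comment> \<open>The product of the transition monoid applies its right factor last, so right
    multiplication acts coordinatewise, as in the power.\<close>
  have \<delta>23: "?\<delta>3 x j = ?\<delta>2 x j" if "x \<in> H" for x j
  proof
    have x: "x q < n" if "q < n" for q using PiE_mem[of x "{0..<n}" "\<lambda>_. {0..<n}" q] H_X \<open>x \<in> H\<close> that by auto
    show "?\<delta>3 x j q = ?\<delta>2 x j q" for q
      using x[of q] by (auto simp: trans_monoid_def)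
  qed
  have fin_X: "finite ?X" by (intro finite_PiE) auto
  have G3: "Gamma_identity H {0..<N} ?\<delta>3"
    by (rule Gamma_identity_subautomaton[OF G2 cl2 cl3 fin_X, of "\<lambda>x. x"]) (use H_X \<delta>23 in auto)

  have cl4: "closed_action {0..<N} {0..<N} (group_automaton G e)"
    using idx(1) e_G by (auto simp: closed_action_def group_automaton_def N_def idx_def)
  \<comment> \<open>The homomorphism \<open>h\<close> turns right multiplication by the function of
    \<open>word j\<close> into right multiplication by \<open>e j\<close>; \<open>idx\<close> passes
    from elements of \<open>G\<close> to their numbers.\<close>
  have "Gamma_identity {0..<N} {0..<N} (group_automaton G e)"
  proof (rule Gamma_identity_quotient[OF G3 cl3 cl4])
    show "finite H" using H_X fin_X by (rule finite_subset)
    show "(\<lambda>x. idx (h x)) ` H = {0..<N}"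
    proof
      show "(\<lambda>x. idx (h x)) ` H \<subseteq> {0..<N}" using idx(1) by (auto simp: surj[symmetric])
      show "{0..<N} \<subseteq> (\<lambda>x. idx (h x)) ` H"
      proof
        fix j assume "j \<in> {0..<N}"
        then show "j \<in> (\<lambda>x. idx (h x)) ` H"
          using word(3,4)[of j] idx_e[of j] by (intro image_eqI[of _ _ "\<lambda>q\<in>{0..<n}. foldl \<delta> q (word j)"]) auto
      qed
    qed
    fix x j assume x: "x \<in> H" and j: "j \<in> {0..<N}"
    have "h x \<in> carrier G" using x surj by blast
    then show "idx (h (?\<delta>3 x j)) = group_automaton G e (idx (h x)) j"
      using x j word(3,4)[of j] idx(2) by (simp add: h_mult group_automaton_def idx_def N_def)
  qed simp
  then show "satisfies_Gamma K (card (carrier G)) (card (carrier G)) (group_automaton G e)"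
    using satisfies_Gamma_if_Gam[OF _ _ cl4] N by (simp add: N_def)
qed

end
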